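(* Let $I$ be a (possibly infinite) set and let $M_I(B)$ be the skew and twisted matrix algebra defined by unital rings $B_i$ ($i\in I$), ring isomorphisms $\sigma_{ij}$, units $\alpha_{ijk}$ and multiplications $*_{ijk}$. Then $M_I(B)$ is simple if and only if for each $i\in I$ the ring $B_i$ is simple. In particular, all of the rings $M_I(\mathbb R)$, $M_I(\mathbb C)$, $M_I(\mathbb H)$, $M_I(\mathbb O)$, $M_I(\mathbb S)$, etc. (i.e. $M_I(B)$ with every $B_i$ equal to $C_n$, for a fixed $n\ge 0$) are simple.
   Context: Rings are not necessarily associative. A ring is simple if it has no (two-sided) ideals other than $\{0\}$ and itself. Skew and twisted matrix algebras: let $I$ be a set. Suppose given non-zero unital rings $B_i$ ($i\in I$); ring isomorphisms $\sigma_{ij}:B_j\to B_i$ ($i,j\in I$) with $\sigma_{ii}=\mathrm{id}_{B_i}$ and $\sigma_{ij}\sigma_{jk}=\sigma_{ik}$ for all $i,j,k$; for each $(i,j,k)\in I^3$ a unit $\alpha_{ijk}\in B_i$, with $\alpha_{ijk}=1_{B_i}$ whenever $i=j$ or $j=k$, which commutes and associates with any two elements of $B_i$, i.e. $\alpha_{ijk}(bc)=(b\alpha_{ijk})c=b(\alpha_{ijk}c)=(bc)\alpha_{ijk}$ for $b,c\in B_i$; and for each $(i,j,k)\in I^3$ let $*_{ijk}$ denote either the ordinary multiplication on $B_i$ or the opposite multiplication on $B_i$. Then $M_I(B)$ is the set of formal sums $\sum_{i,j\in I}b_{ij}u_{ij}$ with $b_{ij}\in B_i$, all but finitely many zero (regarded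 as matrices over the index set $I$), with entrywise addition and multiplication given by the biadditive extension of $(au_{ij})(bu_{jk})=(a*_{ijk}\sigma_{ij}(b))\alpha_{ijk}u_{ik}$ for $a\in B_i$, $b\in B_j$, and $(au_{ij})(bu_{lk})=0$ if $j\ne l$. Cayley-Dickson algebras: $C_0=\mathbb R$ with trivial involution, and $C_{n+1}=\{a+bu: a,b\in C_n\}$ with product $(a+bu)(c+du)=(ac-\overline d\,b)+(da+b\,\overline c)u$ and involution $\overline{a+bu}=\overline a-bu$. Thus $C_1=\mathbb C$, $C_2=\mathbb H$ (quaternions), $C_3=\mathbb O$ (octonions), $C_4=\mathbb S$ (sedenions), and so on. *)

theory Defs
  imports Complex_Main "HOL-Algebra.QuotRing"
begin

section \<open>Rings without associativity\<close>

text \<open>The locale \<^locale>\<open>ring\<close> of HOL-Algebra assumes associativity and a unit. Here neither is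
  assumed: the field \<open>one\<close> of the record carries no meaning in \<open>nonassoc_ring\<close>.\<close>

locale nonassoc_ring = abelian_group R for R (structure) +
  assumes mult_closed: "\<lbrakk>x \<in> carrier R; y \<in> carrier R\<rbrakk> \<Longrightarrow> x \<otimes> y \<in> carrier R"
    and distrib_right:
      "\<lbrakk>x \<in> carrier R; y \<in> carrier R; z \<in> carrier R\<rbrakk> \<Longrightarrow> (x \<oplus> y) \<otimes> z = x \<otimes> z \<oplus> y \<otimes> z"
    and distrib_left:
      "\<lbrakk>x \<in> carrier R; y \<in> carrier R; z \<in> carrier R\<rbrakk> \<Longrightarrow> z \<otimes> (x \<oplus> y) = z \<otimes> x \<oplus> z \<otimes> y"

context nonassoc_ring begin
lemma mult_zero_right: "x \<in> carrier R \<Longrightarrow> x \<otimes> \<zero> = \<zero>"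
  by (metis (no_types, lifting) add.l_cancel_one' distrib_left mult_closed r_zero zero_closed)
lemma mult_zero_left: "x \<in> carrier R \<Longrightarrow> \<zero> \<otimes> x = \<zero>"
  by (metis (no_types, lifting) add.l_cancel_one' distrib_right mult_closed r_zero zero_closed)
end

locale unital_nonassoc_ring = nonassoc_ring +
  assumes unit_closed: "\<one> \<in> carrier R"
    and unit_left: "x \<in> carrier R \<Longrightarrow> \<one> \<otimes> x = x"
    and unit_right: "x \<in> carrier R \<Longrightarrow> x \<otimes> \<one> = x"

locale two_sided_ideal = additive_subgroup J R for J and R (structure) +
  assumes mult_left_closed: "\<lbrakk>x \<in> carrier R; a \<in> J\<rbrakk> \<Longrightarrow> x \<otimes> a \<in> J"
    and mult_right_closed: "\<lbrakk>x \<in> carrier R; a \<in> J\<rbrakk> \<Longrightarrow> a \<otimes> x \<in> J"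

text \<open>The zero ring counts as simple under this definition. This matters only for the matrix
  algebra over the empty index set.\<close>

locale simple_nonassoc_ring = nonassoc_ring +
  assumes ideals_trivial: "two_sided_ideal J R \<Longrightarrow> J = {\<zero>} \<or> J = carrier R"


section \<open>Skew and twisted matrix algebras\<close>

locale skew_twisted_data =
  fixes I :: "'i set"
    and B :: "'i \<Rightarrow> ('b, 'm) ring_scheme"
    and \<sigma> :: "'i \<Rightarrow> 'i \<Rightarrow> 'b \<Rightarrow> 'b"
    and \<alpha> :: "'i \<Rightarrow> 'i \<Rightarrow> 'i \<Rightarrow> 'b"
  assumes base_ring: "i \<in> I \<Longrightarrow> unital_nonassoc_ring (B i)"
    and base_nonzero: "i \<in> I \<Longrightarrow> \<one>\<^bsub>B i\<^esub> \<noteq> \<zero>\<^bsub>B i\<^esub>"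
    and sigma_iso: "\<lbrakk>i \<in> I; j \<in> I\<rbrakk> \<Longrightarrow> \<sigma> i j \<in> ring_iso (B j) (B i)"
    and sigma_refl: "\<lbrakk>i \<in> I; b \<in> carrier (B i)\<rbrakk> \<Longrightarrow> \<sigma> i i b = b"
    and sigma_comp:
      "\<lbrakk>i \<in> I; j \<in> I; k \<in> I; b \<in> carrier (B k)\<rbrakk> \<Longrightarrow> \<sigma> i j (\<sigma> j k b) = \<sigma> i k b"
    and alpha_unit: "\<lbrakk>i \<in> I; j \<in> I; k \<in> I\<rbrakk> \<Longrightarrow> \<alpha> i j k \<in> Units (B i)"
    and alpha_normalized:
      "\<lbrakk>i \<in> I; j \<in> I; k \<in> I; i = j \<or> j = k\<rbrakk> \<Longrightarrow> \<alpha> i j k = \<one>\<^bsub>B i\<^esub>"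
    and alpha_central:
      "\<lbrakk>i \<in> I; j \<in> I; k \<in> I; b \<in> carrier (B i); c \<in> carrier (B i)\<rbrakk> \<Longrightarrow>
        \<alpha> i j k \<otimes>\<^bsub>B i\<^esub> (b \<otimes>\<^bsub>B i\<^esub> c) = (b \<otimes>\<^bsub>B i\<^esub> \<alpha> i j k) \<otimes>\<^bsub>B i\<^esub> c \<and>
        (b \<otimes>\<^bsub>B i\<^esub> \<alpha> i j k) \<otimes>\<^bsub>B i\<^esub> c = b \<otimes>\<^bsub>B i\<^esub> (\<alpha> i j k \<otimes>\<^bsub>B i\<^esub> c) \<and>
        b \<otimes>\<^bsub>B i\<^esub> (\<alpha> i j k \<otimes>\<^bsub>B i\<^esub> c) = (b \<otimes>\<^bsub>B i\<^esub> c) \<otimes>\<^bsub>B i\<^esub> \<alpha> i j k"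

text \<open>The flag \<open>opp i j k\<close> selects the multiplication \<open>*\<^sub>i\<^sub>j\<^sub>k\<close> on \<open>B i\<close>: the opposite one if it is
  true, the ordinary one if it is false. Every family of flags is admissible, so \<open>opp\<close> is not a
  parameter of the locale above.\<close>

definition choose_mult :: "('b, 'm) ring_scheme \<Rightarrow> bool \<Rightarrow> 'b \<Rightarrow> 'b \<Rightarrow> 'b" where
  "choose_mult R p a b = (if p then b \<otimes>\<^bsub>R\<^esub> a else a \<otimes>\<^bsub>R\<^esub> b)"

text \<open>A formal sum of terms \<open>b\<^sub>i\<^sub>j u\<^sub>i\<^sub>j\<close> is the function \<open>(i, j) \<mapsto> b\<^sub>i\<^sub>j\<close> on \<open>I \<times> I\<close>, extended by
  \<open>undefined\<close>. The product is the biadditive extension of the rule for monomials, collected at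
  \<open>u\<^sub>i\<^sub>k\<close>. The summation index \<open>j\<close> is restricted to the non-zero entries of the \<open>i\<close>-th row of the
  left factor because \<^const>\<open>finsum\<close> over an infinite set is zero; the omitted summands vanish.
  For infinite \<open>I\<close> there is no unit, and the field \<open>one\<close> (the identity matrix) then lies outside
  the carrier.\<close>

definition skew_twisted_matrix_ring ::
  "'i set \<Rightarrow> ('i \<Rightarrow> ('b, 'm) ring_scheme) \<Rightarrow> ('i \<Rightarrow> 'i \<Rightarrow> 'b \<Rightarrow> 'b) \<Rightarrow> ('i \<Rightarrow> 'i \<Rightarrow> 'i \<Rightarrow> 'b) \<Rightarrow>
    ('i \<Rightarrow> 'i \<Rightarrow> 'i \<Rightarrow> bool) \<Rightarrow> ('i \<times> 'i \<Rightarrow> 'b) ring" where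
  "skew_twisted_matrix_ring I B \<sigma> \<alpha> opp =
    \<lparr>carrier = {x \<in> (\<Pi>\<^sub>E (i, j) \<in> I \<times> I. carrier (B i)).
        finite {(i, j) \<in> I \<times> I. x (i, j) \<noteq> \<zero>\<^bsub>B i\<^esub>}},
     mult = (\<lambda>x y. \<lambda>(i, k) \<in> I \<times> I.
       \<Oplus>\<^bsub>B i\<^esub> j \<in> {j \<in> I. x (i, j) \<noteq> \<zero>\<^bsub>B i\<^esub>}.
         choose_mult (B i) (opp i j k) (x (i, j)) (\<sigma> i j (y (j, k))) \<otimes>\<^bsub>B i\<^esub> \<alpha> i j k),
     one = (\<lambda>(i, j) \<in> I \<times> I. if i = j then \<one>\<^bsub>B i\<^esub> else \<zero>\<^bsub>B i\<^esub>),
     zero = (\<lambda>(i, j) \<in> I \<times> I. \<zero>\<^bsub>B i\<^esub>),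
     add = (\<lambda>x y. \<lambda>(i, j) \<in> I \<times> I. x (i, j) \<oplus>\<^bsub>B i\<^esub> y (i, j))\<rparr>"

definition matrix_monomial ::
  "'i set \<Rightarrow> ('i \<Rightarrow> ('b, 'm) ring_scheme) \<Rightarrow> 'b \<Rightarrow> 'i \<Rightarrow> 'i \<Rightarrow> 'i \<times> 'i \<Rightarrow> 'b" where
  "matrix_monomial I B b i j = (\<lambda>(k, l) \<in> I \<times> I. if k = i \<and> l = j then b else \<zero>\<^bsub>B k\<^esub>)"


text \<open>Consistency check: the product on monomials is the one that defines the algebra.\<close>

context skew_twisted_data begin
lemma term_closed: assumes "i \<in> I" "j \<in> I" "k \<in> I" "a \<in> carrier (B i)" "b \<in> carrier (B j)"
  shows "choose_mult (B i) (opp i j k) a (\<sigma> i j b) \<otimes>\<^bsub>B i\<^esub> \<alpha> i j k \<in> carrier (B i)"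
proof -
  interpret unital_nonassoc_ring "B i" using base_ring assms by blast
  show ?thesis using assms sigma_iso[of i j] alpha_unit[of i j k]
    by (auto simp: choose_mult_def Units_def ring_iso_def ring_hom_def intro!: mult_closed)
qed

lemma sigma_zero: assumes "i \<in> I" "j \<in> I" shows "\<sigma> i j \<zero>\<^bsub>B j\<^esub> = \<zero>\<^bsub>B i\<^esub>"
proof -
  interpret i: unital_nonassoc_ring "B i" using base_ring assms by blast
  interpret j: unital_nonassoc_ring "B j" using base_ring assms by blast
  have h: "\<sigma> i j \<in> ring_hom (B j) (B i)" using sigma_iso assms by (auto simp: ring_iso_def)
  have "\<sigma> i j \<zero>\<^bsub>B j\<^esub> \<oplus>\<^bsub>B i\<^esub> \<sigma> i j \<zero>\<^bsub>B j\<^esub> = \<sigma> i j \<zero>\<^bsub>B j\<^esub>"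
    using ring_hom_add[OF h, of "\<zero>\<^bsub>B j\<^esub>" "\<zero>\<^bsub>B j\<^esub>"] by simp
  thus ?thesis using ring_hom_closed[OF h, of "\<zero>\<^bsub>B j\<^esub>"] by simp
qed

lemma matrix_monomial_mult:
  assumes ij: "i \<in> I" "j \<in> I" and lk: "l \<in> I" "k \<in> I"
    and a: "a \<in> carrier (B i)" and b: "b \<in> carrier (B l)"
  shows "matrix_monomial I B a i j \<otimes>\<^bsub>skew_twisted_matrix_ring I B \<sigma> \<alpha> opp\<^esub> matrix_monomial I B b l k =
    (if j = l
     then matrix_monomial I B
       (choose_mult (B i) (opp i j k) a (\<sigma> i j b) \<otimes>\<^bsub>B i\<^esub> \<alpha> i j k) i k
     else \<zero>\<^bsub>skew_twisted_matrix_ring I B \<sigma> \<alpha> opp\<^esub>)" (is "?L = ?R")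
proof (rule ext)
  fix p :: "'i \<times> 'i" obtain r s where p: "p = (r, s)" by (cases p)
  let ?x = "matrix_monomial I B a i j" and ?y = "matrix_monomial I B b l k"
  show "?L p = ?R p"
  proof (cases "r \<in> I \<and> s \<in> I")
    case False
    thus ?thesis by (auto simp: p skew_twisted_matrix_ring_def matrix_monomial_def restrict_def)
  next
    case True
    hence rs: "r \<in> I" "s \<in> I" by auto
    interpret r: unital_nonassoc_ring "B r" using base_ring rs by blast
    have null: "choose_mult (B r) q x \<zero>\<^bsub>B r\<^esub> \<otimes>\<^bsub>B r\<^esub> \<alpha> r t s = \<zero>\<^bsub>B r\<^esub>"
      if "x \<in> carrier (B r)" "t \<in> I" for q x t
      using that alpha_unit[of r t s] rs by (auto simp: choose_mult_def r.mult_zero_left r.mult_zero_right Units_def)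
    have null2: "choose_mult (B r) q \<zero>\<^bsub>B r\<^esub> x \<otimes>\<^bsub>B r\<^esub> \<alpha> r t s = \<zero>\<^bsub>B r\<^esub>"
      if "x \<in> carrier (B r)" "t \<in> I" for q x t
      using that alpha_unit[of r t s] rs by (auto simp: choose_mult_def r.mult_zero_left r.mult_zero_right Units_def)
    have L: "?L p = (\<Oplus>\<^bsub>B r\<^esub> t \<in> {t \<in> I. ?x (r, t) \<noteq> \<zero>\<^bsub>B r\<^esub>}.
         choose_mult (B r) (opp r t s) (?x (r, t)) (\<sigma> r t (?y (t, s))) \<otimes>\<^bsub>B r\<^esub> \<alpha> r t s)"
      using rs by (simp add: p skew_twisted_matrix_ring_def)
    show ?thesis
    proof (cases "r = i \<and> a \<noteq> \<zero>\<^bsub>B i\<^esub>")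
      case False
      hence E: "{t \<in> I. ?x (r, t) \<noteq> \<zero>\<^bsub>B r\<^esub>} = {}" using rs by (auto simp: matrix_monomial_def)
      have "?L p = \<zero>\<^bsub>B r\<^esub>" unfolding L E by (rule r.finsum_empty)
      moreover have "?R p = \<zero>\<^bsub>B r\<^esub>"
      proof -
        have h: "\<sigma> r j \<in> ring_hom (B j) (B r)" using sigma_iso rs ij by (auto simp: ring_iso_def)
        show ?thesis using False rs lk ij b null2[of "\<sigma> r j b" j] ring_hom_closed[OF h, of b]
          by (auto simp: p skew_twisted_matrix_ring_def matrix_monomial_def)
      qed
      ultimately show ?thesis by simp
    next
      case True
      hence E: "{t \<in> I. ?x (r, t) \<noteq> \<zero>\<^bsub>B r\<^esub>} = {j}" using rs ij by (auto simp: matrix_monomial_def)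
      interpret j: unital_nonassoc_ring "B j" using base_ring ij by blast
      have y: "?y (j, s) \<in> carrier (B j)" using rs ij b by (auto simp: matrix_monomial_def)
      have x: "?x (r, j) = a" using True ij rs by (auto simp: matrix_monomial_def)
      have "?L p = choose_mult (B r) (opp r j s) a (\<sigma> r j (?y (j, s))) \<otimes>\<^bsub>B r\<^esub> \<alpha> r j s"
      proof -
        have "choose_mult (B r) (opp r j s) a (\<sigma> r j (?y (j, s))) \<otimes>\<^bsub>B r\<^esub> \<alpha> r j s \<in> carrier (B r)"
          using term_closed True y a rs ij by blast
        thus ?thesis unfolding L E by (subst r.finsum_insert) (simp_all add: x r.finsum_empty)
      qed
      thus ?thesis using True rs ij lk a null[of a j "opp r j s"]
        by (auto simp: p matrix_monomial_def skew_twisted_matrix_ring_def sigma_zero)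
    qed
  qed
qed
end


section \<open>Cayley-Dickson algebras\<close>

text \<open>All the algebras \<open>C\<^sub>n\<close> live in one type, that of binary trees with real leaves: \<open>C\<^sub>n\<close> consists
  of the full trees of height \<open>n\<close>, and \<open>Double a b\<close> stands for \<open>a + b u\<close>.\<close>

datatype cd_tree = Scalar (scalar_part: real) | Double (left_part: cd_tree) (right_part: cd_tree)

record 'a star_ring = "'a ring" +
  involution :: "'a \<Rightarrow> 'a"

definition real_star_ring :: "cd_tree star_ring" where
  "real_star_ring =
    \<lparr>carrier = range Scalar,
     mult = (\<lambda>x y. Scalar (scalar_part x * scalar_part y)),
     one = Scalar 1,
     zero = Scalar 0,
     add = (\<lambda>x y. Scalar (scalar_part x + scalar_part y)),
     involution = (\<lambda>x. x)\<rparr>"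

definition cd_double :: "cd_tree star_ring \<Rightarrow> cd_tree star_ring" where
  "cd_double A =
    \<lparr>carrier = {Double a b |a b. a \<in> carrier A \<and> b \<in> carrier A},
     mult = (\<lambda>x y. let a = left_part x; b = right_part x; c = left_part y; d = right_part y in
       Double (a \<otimes>\<^bsub>A\<^esub> c \<ominus>\<^bsub>A\<^esub> involution A d \<otimes>\<^bsub>A\<^esub> b) (d \<otimes>\<^bsub>A\<^esub> a \<oplus>\<^bsub>A\<^esub> b \<otimes>\<^bsub>A\<^esub> involution A c)),
     one = Double \<one>\<^bsub>A\<^esub> \<zero>\<^bsub>A\<^esub>,
     zero = Double \<zero>\<^bsub>A\<^esub> \<zero>\<^bsub>A\<^esub>,
     add = (\<lambda>x y. Double (left_part x \<oplus>\<^bsub>A\<^esub> left_part y) (right_part x \<oplus>\<^bsub>A\<^esub> right_part y)),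
     involution = (\<lambda>x. Double (involution A (left_part x)) (\<ominus>\<^bsub>A\<^esub> right_part x))\<rparr>"

primrec cayley_dickson :: "nat \<Rightarrow> cd_tree star_ring" where
  "cayley_dickson 0 = real_star_ring"
| "cayley_dickson (Suc n) = cd_double (cayley_dickson n)"

text \<open>The rest of the theory shows that each \<open>C\<^sub>n\<close> is a non-zero unital ring, so that the constant
  family with trivial \<open>\<sigma>\<close> and \<open>\<alpha>\<close> is an instance of the construction.\<close>

definition nonzero_star_ring :: "cd_tree star_ring \<Rightarrow> bool" where
  "nonzero_star_ring A \<longleftrightarrow> unital_nonassoc_ring A \<and> \<one>\<^bsub>A\<^esub> \<noteq> \<zero>\<^bsub>A\<^esub> \<and>
    involution A \<in> carrier A \<rightarrow> carrier A \<and>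
    (\<forall>x\<in>carrier A. \<forall>y\<in>carrier A.
      involution A (x \<oplus>\<^bsub>A\<^esub> y) = involution A x \<oplus>\<^bsub>A\<^esub> involution A y) \<and>
    involution A \<one>\<^bsub>A\<^esub> = \<one>\<^bsub>A\<^esub>"

lemma nonzero_star_ring_real: "nonzero_star_ring real_star_ring"
proof -
  have "abelian_group real_star_ring"
  proof (rule abelian_groupI)
    fix x assume "x \<in> carrier real_star_ring"
    then show "\<exists>y\<in>carrier real_star_ring. y \<oplus>\<^bsub>real_star_ring\<^esub> x = \<zero>\<^bsub>real_star_ring\<^esub>"
      by (intro bexI[of _ "Scalar (- scalar_part x)"]) (auto simp: real_star_ring_def)
  qed (auto simp: real_star_ring_def)
  thus ?thesis
    unfolding nonzero_star_ring_def unital_nonassoc_ring_def nonassoc_ring_def nonassoc_ring_axioms_def unital_nonassoc_ring_axioms_def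
    by (auto simp: real_star_ring_def algebra_simps)
qed

lemma nonzero_star_ring_double: assumes "nonzero_star_ring A" shows "nonzero_star_ring (cd_double A)"
proof -
  interpret A: unital_nonassoc_ring A using assms by (simp add: nonzero_star_ring_def)
  have nz: "\<one>\<^bsub>A\<^esub> \<noteq> \<zero>\<^bsub>A\<^esub>" and cl: "\<And>x. x \<in> carrier A \<Longrightarrow> involution A x \<in> carrier A" and
    ad: "\<And>x y. x \<in> carrier A \<Longrightarrow> y \<in> carrier A \<Longrightarrow> involution A (x \<oplus>\<^bsub>A\<^esub> y) = involution A x \<oplus>\<^bsub>A\<^esub> involution A y"
    and one: "involution A \<one>\<^bsub>A\<^esub> = \<one>\<^bsub>A\<^esub>" using assms by (auto simp: nonzero_star_ring_def)
  have z: "involution A \<zero>\<^bsub>A\<^esub> = \<zero>\<^bsub>A\<^esub>"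
    using ad[of "\<zero>\<^bsub>A\<^esub>" "\<zero>\<^bsub>A\<^esub>"] cl[of "\<zero>\<^bsub>A\<^esub>"] by simp
  note s = cd_double_def Let_def a_minus_def A.mult_closed A.distrib_left A.distrib_right A.mult_zero_left A.mult_zero_right cl ad one z A.a_ac A.minus_add A.unit_closed A.unit_left A.unit_right
  have "abelian_group (cd_double A)"
  proof (rule abelian_groupI)
    fix x assume "x \<in> carrier (cd_double A)"
    then obtain a b where "x = Double a b" "a \<in> carrier A" "b \<in> carrier A" by (auto simp: cd_double_def)
    thus "\<exists>y\<in>carrier (cd_double A). y \<oplus>\<^bsub>cd_double A\<^esub> x = \<zero>\<^bsub>cd_double A\<^esub>"
      by (intro bexI[of _ "Double (\<ominus>\<^bsub>A\<^esub> a) (\<ominus>\<^bsub>A\<^esub> b)"]) (auto simp: cd_double_def A.l_neg)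
  qed (auto simp: cd_double_def A.a_ac)
  thus ?thesis using nz
    unfolding nonzero_star_ring_def unital_nonassoc_ring_def nonassoc_ring_def nonassoc_ring_axioms_def unital_nonassoc_ring_axioms_def
    by (auto simp: s)
qed

lemma nonzero_star_ring_cayley_dickson: "nonzero_star_ring (cayley_dickson n)" by (induction n) (auto simp: nonzero_star_ring_real nonzero_star_ring_double)

lemma cayley_dickson_constant_data: "skew_twisted_data I (\<lambda>i. cayley_dickson n) (\<lambda>i j b. b) (\<lambda>i j k. \<one>\<^bsub>cayley_dickson n\<^esub>)"
proof -
  interpret unital_nonassoc_ring "cayley_dickson n" using nonzero_star_ring_cayley_dickson by (simp add: nonzero_star_ring_def)
  have "\<one>\<^bsub>cayley_dickson n\<^esub> \<in> Units (cayley_dickson n)"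
    using unit_closed unit_left[OF unit_closed] by (auto simp: Units_def)
  moreover have "\<one>\<^bsub>cayley_dickson n\<^esub> \<noteq> \<zero>\<^bsub>cayley_dickson n\<^esub>"
    using nonzero_star_ring_cayley_dickson by (simp add: nonzero_star_ring_def)
  ultimately show ?thesis
    using unital_nonassoc_ring_axioms
    by unfold_locales
      (auto simp: ring_iso_def ring_hom_def bij_betw_def mult_closed unit_left unit_right
        intro: unital_nonassoc_ring_axioms)
qed

end

theory Submission
  imports Defs
begin

text \<open>If every \<open>B\<^sub>i\<close> is simple, a non-zero ideal \<open>J\<close> of the matrix algebra contains some non-zero
  \<open>b u\<^sub>i\<^sub>j\<close>, cut out of a matrix by multiplying with \<open>1 u\<^sub>i\<^sub>i\<close> and \<open>1 u\<^sub>j\<^sub>j\<close>; multiplying with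
  \<open>1 u\<^sub>j\<^sub>i\<close> moves it to the diagonal. The coefficients \<open>b\<close> with \<open>b u\<^sub>i\<^sub>i \<in> J\<close> form an ideal of \<open>B\<^sub>i\<close>,
  whichever multiplication \<open>*\<^sub>i\<^sub>i\<^sub>i\<close> is, so \<open>1 u\<^sub>i\<^sub>i \<in> J\<close>, and this generates all monomials. Off the
  diagonal the argument fails, because \<open>*\<^sub>i\<^sub>i\<^sub>j\<close> and \<open>*\<^sub>i\<^sub>j\<^sub>j\<close> may be opposite to each other.
  Conversely, an ideal \<open>K\<close> of \<open>B\<^sub>i\<close> yields the ideal of all matrices with \<open>k\<close>-th row in \<open>\<sigma>\<^sub>k\<^sub>i(K)\<close>.
  Finally, \<open>C\<^sub>n\<close> is simple because \<open>x\<close> times its conjugate is a positive real number for \<open>x \<noteq> 0\<close>.\<close>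

section \<open>Ideals\<close>

context nonassoc_ring
begin

text \<open>For rings that may lack a unit, such as the matrix algebra over an infinite index set,
  where closure under negatives has to be checked by itself.\<close>

lemma two_sided_idealI:
  assumes "J \<subseteq> carrier R" "\<zero> \<in> J"
    and "\<And>a b. a \<in> J \<Longrightarrow> b \<in> J \<Longrightarrow> a \<oplus> b \<in> J"
    and "\<And>a. a \<in> J \<Longrightarrow> \<ominus> a \<in> J"
    and "\<And>x a. x \<in> carrier R \<Longrightarrow> a \<in> J \<Longrightarrow> x \<otimes> a \<in> J"
    and "\<And>x a. x \<in> carrier R \<Longrightarrow> a \<in> J \<Longrightarrow> a \<otimes> x \<in> J"
  shows "two_sided_ideal J R"
proof (intro two_sided_ideal.intro two_sided_ideal_axioms.intro additive_subgroup.intro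
    subgroup.intro)
  show "inv\<^bsub>add_monoid R\<^esub> a \<in> J" if "a \<in> J" for a
    using assms(4)[OF that] by (simp only: a_inv_def)
qed (use assms in simp_all)

end

context two_sided_ideal
begin

text \<open>The locale carries no ring axioms for \<open>R\<close>, hence the explicit monoid
  hypothesis. The index set may be infinite: \<open>finsum\<close> is then zero by convention, and
  zero lies in \<open>J\<close>.\<close>

lemma ideal_finsum_closed:
  assumes "abelian_monoid R" "\<And>s. s \<in> S \<Longrightarrow> f s \<in> J"
  shows "finsum R f S \<in> J"
proof -
  interpret abelian_monoid R by fact
  have *: "f \<in> S \<rightarrow> carrier R" using assms(2) a_Hcarr by blast
  show ?thesis
  proof (cases "finite S")
    case True
    then show ?thesis using * assms(2)
      by (induction S) (auto simp: Pi_iff)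
  qed (simp add: finsum_infinite)
qed

text \<open>Passing to the opposite multiplication exchanges left and right absorption, and
  \<open>J\<close> has both. So ideals do not see the flag, here or in the mirrored lemma that
  follows.\<close>

lemma choose_mult_ideal_left:
  assumes "x \<in> carrier R" "a \<in> J" shows "choose_mult R p x a \<in> J"
  using assms by (simp add: choose_mult_def mult_left_closed mult_right_closed)

lemma choose_mult_ideal_right:
  assumes "x \<in> carrier R" "a \<in> J" shows "choose_mult R p a x \<in> J"
  using assms by (simp add: choose_mult_def mult_left_closed mult_right_closed)

end

context unital_nonassoc_ring
begin

lemma ideal_eq_carrierI:
  assumes "two_sided_ideal J R" "\<one> \<in> J" shows "J = carrier R"
proof -
  interpret two_sided_ideal J R by fact
  have "x \<in> J" if "x \<in> carrier R" for x
    using mult_left_closed[OF that assms(2)] that by (simp add: unit_right)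
  then show ?thesis using a_Hcarr by blast
qed

lemma uminus_eq_mult: assumes "x \<in> carrier R" shows "\<ominus> x = (\<ominus> \<one>) \<otimes> x"
proof -
  have "(\<ominus> \<one>) \<otimes> x \<oplus> x = (\<ominus> \<one> \<oplus> \<one>) \<otimes> x"
    using assms unit_closed by (simp add: distrib_right unit_left)
  also have "\<dots> = \<zero>" using assms unit_closed by (simp add: l_neg mult_zero_left)
  finally show ?thesis using assms unit_closed by (simp add: minus_equality mult_closed)
qed

text \<open>With a unit, negation is multiplication by -1, so left absorption takes care of
  negatives. This is the criterion applied to the coefficient rings.\<close>

lemma unital_two_sided_idealI:
  assumes "J \<subseteq> carrier R" "\<zero> \<in> J"
    and "\<And>a b. a \<in> J \<Longrightarrow> b \<in> J \<Longrightarrow> a \<oplus> b \<in> J"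
    and l: "\<And>x a. x \<in> carrier R \<Longrightarrow> a \<in> J \<Longrightarrow> x \<otimes> a \<in> J"
    and "\<And>x a. x \<in> carrier R \<Longrightarrow> a \<in> J \<Longrightarrow> a \<otimes> x \<in> J"
  shows "two_sided_ideal J R"
proof (rule two_sided_idealI)
  fix a assume "a \<in> J"
  then have "(\<ominus> \<one>) \<otimes> a \<in> J" using l unit_closed by simp
  moreover have "a \<in> carrier R" using \<open>a \<in> J\<close> assms(1) by blast
  ultimately show "\<ominus> a \<in> J" by (simp only: uminus_eq_mult[of a])
qed (use assms in auto)

end


section \<open>The matrix algebra\<close>

context skew_twisted_data
begin

context
  fixes opp :: "'i \<Rightarrow> 'i \<Rightarrow> 'i \<Rightarrow> bool"
begin

abbreviation M where "M \<equiv> skew_twisted_matrix_ring I B \<sigma> \<alpha> opp"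
abbreviation E where "E \<equiv> matrix_monomial I B"
abbreviation summand where
  "summand i j k a b \<equiv> choose_mult (B i) (opp i j k) a (\<sigma> i j b) \<otimes>\<^bsub>B i\<^esub> \<alpha> i j k"

section \<open>Membership in the carrier and equality by entries\<close>

lemma carrier_iff:
  "x \<in> carrier M \<longleftrightarrow> x \<in> extensional (I \<times> I) \<and> (\<forall>i\<in>I. \<forall>j\<in>I. x (i, j) \<in> carrier (B i)) \<and>
     finite {(i, j) \<in> I \<times> I. x (i, j) \<noteq> \<zero>\<^bsub>B i\<^esub>}"
  by (auto simp: skew_twisted_matrix_ring_def PiE_def Pi_def)

lemma entry_closed: "\<lbrakk>x \<in> carrier M; i \<in> I; j \<in> I\<rbrakk> \<Longrightarrow> x (i, j) \<in> carrier (B i)"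
  by (auto simp: carrier_iff)

text \<open>\<open>F\<close> is any finite set of positions that contains the support, so each use
  can choose a convenient one instead of determining the support exactly.\<close>

lemma carrierI:
  assumes "x \<in> extensional (I \<times> I)"
    and "\<And>i j. i \<in> I \<Longrightarrow> j \<in> I \<Longrightarrow> x (i, j) \<in> carrier (B i)"
    and "finite F"
    and "\<And>i j. i \<in> I \<Longrightarrow> j \<in> I \<Longrightarrow> x (i, j) \<noteq> \<zero>\<^bsub>B i\<^esub> \<Longrightarrow> (i, j) \<in> F"
  shows "x \<in> carrier M"
  unfolding carrier_iff using assms by (auto intro: finite_subset[OF _ assms(3)])

lemma finite_support: "x \<in> carrier M \<Longrightarrow> finite {(i, j) \<in> I \<times> I. x (i, j) \<noteq> \<zero>\<^bsub>B i\<^esub>}"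
  unfolding carrier_iff by blast

lemma base_abelian_group: "i \<in> I \<Longrightarrow> abelian_group (B i)"
  using base_ring by (simp add: nonassoc_ring_def unital_nonassoc_ring_def)

lemma finite_row: "\<lbrakk>x \<in> carrier M; i \<in> I\<rbrakk> \<Longrightarrow> finite {j \<in> I. x (i, j) \<noteq> \<zero>\<^bsub>B i\<^esub>}"
proof -
  assume x: "x \<in> carrier M" and i: "i \<in> I"
  have "{j \<in> I. x (i, j) \<noteq> \<zero>\<^bsub>B i\<^esub>} \<subseteq> snd ` {(i, j) \<in> I \<times> I. x (i, j) \<noteq> \<zero>\<^bsub>B i\<^esub>}"
  proof
    fix j assume "j \<in> {j \<in> I. x (i, j) \<noteq> \<zero>\<^bsub>B i\<^esub>}"
    then show "j \<in> snd ` {(i, j) \<in> I \<times> I. x (i, j) \<noteq> \<zero>\<^bsub>B i\<^esub>}"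
      using i by (intro image_eqI[of _ _ "(i, j)"]) auto
  qed
  then show ?thesis using finite_support[OF x] by (meson finite_imageI finite_subset)
qed

lemma matrix_eqI:
  assumes "x \<in> carrier M" "y \<in> carrier M"
    and "\<And>i j. i \<in> I \<Longrightarrow> j \<in> I \<Longrightarrow> x (i, j) = y (i, j)"
  shows "x = y"
proof (rule extensionalityI[of x "I \<times> I"])
  show "x \<in> extensional (I \<times> I)" "y \<in> extensional (I \<times> I)"
    using assms(1,2) unfolding carrier_iff by blast+
  show "x p = y p" if "p \<in> I \<times> I" for p
    using that assms(3) by (cases p) blast
qed

lemma zero_entry: "\<lbrakk>i \<in> I; j \<in> I\<rbrakk> \<Longrightarrow> \<zero>\<^bsub>M\<^esub> (i, j) = \<zero>\<^bsub>B i\<^esub>"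
  by (simp add: skew_twisted_matrix_ring_def)

lemma add_entry: "\<lbrakk>i \<in> I; j \<in> I\<rbrakk> \<Longrightarrow> (x \<oplus>\<^bsub>M\<^esub> y) (i, j) = x (i, j) \<oplus>\<^bsub>B i\<^esub> y (i, j)"
  by (simp add: skew_twisted_matrix_ring_def)

lemma monomial_entry:
  "\<lbrakk>k \<in> I; l \<in> I\<rbrakk> \<Longrightarrow> E b i j (k, l) = (if k = i \<and> l = j then b else \<zero>\<^bsub>B k\<^esub>)"
  by (simp add: matrix_monomial_def)

section \<open>The terms and the entries of a product\<close>

lemma summand_closed:
  assumes "i \<in> I" "j \<in> I" "k \<in> I" "a \<in> carrier (B i)" "b \<in> carrier (B j)"
  shows "summand i j k a b \<in> carrier (B i)"
  using assms by (rule term_closed)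

lemma sigma_hom: "\<lbrakk>i \<in> I; j \<in> I\<rbrakk> \<Longrightarrow> \<sigma> i j \<in> ring_hom (B j) (B i)"
  using sigma_iso by (auto simp: ring_iso_def)

lemma sigma_closed: "\<lbrakk>i \<in> I; j \<in> I; b \<in> carrier (B j)\<rbrakk> \<Longrightarrow> \<sigma> i j b \<in> carrier (B i)"
  by (rule ring_hom_closed[OF sigma_hom])

lemma sigma_one: "\<lbrakk>i \<in> I; j \<in> I\<rbrakk> \<Longrightarrow> \<sigma> i j \<one>\<^bsub>B j\<^esub> = \<one>\<^bsub>B i\<^esub>"
  by (rule ring_hom_one[OF sigma_hom])

lemma alpha_closed: "\<lbrakk>i \<in> I; j \<in> I; k \<in> I\<rbrakk> \<Longrightarrow> \<alpha> i j k \<in> carrier (B i)"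
  using alpha_unit by (auto simp: Units_def)

text \<open>Without associativity an inverse need not cancel. It does here because \<alpha>
  associates and commutes with any two elements: one instance of \<open>alpha_central\<close>, with
  \<open>c\<close> the inverse \<beta>, makes both products equal to \<open>b\<close> times
  1.\<close>

lemma alpha_inverse:
  assumes "i \<in> I" "j \<in> I" "k \<in> I"
  obtains \<beta> where "\<beta> \<in> carrier (B i)"
    "\<And>b. b \<in> carrier (B i) \<Longrightarrow> (b \<otimes>\<^bsub>B i\<^esub> \<alpha> i j k) \<otimes>\<^bsub>B i\<^esub> \<beta> = b"
    "\<And>b. b \<in> carrier (B i) \<Longrightarrow> (b \<otimes>\<^bsub>B i\<^esub> \<beta>) \<otimes>\<^bsub>B i\<^esub> \<alpha> i j k = b"
proof -
  interpret unital_nonassoc_ring "B i" by (rule base_ring) fact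
  obtain \<beta> where \<beta>: "\<beta> \<in> carrier (B i)" "\<alpha> i j k \<otimes>\<^bsub>B i\<^esub> \<beta> = \<one>\<^bsub>B i\<^esub>"
    using alpha_unit[OF assms] by (auto simp: Units_def)
  show thesis
  proof (rule that[OF \<beta>(1)])
    fix b assume b: "b \<in> carrier (B i)"
    show "(b \<otimes>\<^bsub>B i\<^esub> \<alpha> i j k) \<otimes>\<^bsub>B i\<^esub> \<beta> = b" "(b \<otimes>\<^bsub>B i\<^esub> \<beta>) \<otimes>\<^bsub>B i\<^esub> \<alpha> i j k = b"
      using alpha_central[OF assms b \<beta>(1)] \<beta>(2) unit_right[OF b] by metis+
  qed
qed

lemma summand_zero_left:
  assumes "i \<in> I" "j \<in> I" "k \<in> I" "b \<in> carrier (B j)"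
  shows "summand i j k \<zero>\<^bsub>B i\<^esub> b = \<zero>\<^bsub>B i\<^esub>"
proof -
  interpret unital_nonassoc_ring "B i" by (rule base_ring) fact
  show ?thesis using assms sigma_closed alpha_closed
    by (simp add: choose_mult_def mult_zero_left mult_zero_right)
qed

lemma summand_zero_right:
  assumes "i \<in> I" "j \<in> I" "k \<in> I" "a \<in> carrier (B i)"
  shows "summand i j k a \<zero>\<^bsub>B j\<^esub> = \<zero>\<^bsub>B i\<^esub>"
proof -
  interpret unital_nonassoc_ring "B i" by (rule base_ring) fact
  show ?thesis using assms alpha_closed
    by (simp add: sigma_zero choose_mult_def mult_zero_left mult_zero_right)
qed

lemma summand_add_left:
  assumes "i \<in> I" "j \<in> I" "k \<in> I" "a \<in> carrier (B i)" "a' \<in> carrier (B i)" "b \<in> carrier (B j)"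
  shows "summand i j k (a \<oplus>\<^bsub>B i\<^esub> a') b = summand i j k a b \<oplus>\<^bsub>B i\<^esub> summand i j k a' b"
proof -
  interpret unital_nonassoc_ring "B i" by (rule base_ring) fact
  show ?thesis using assms sigma_closed[of i j b] alpha_closed[of i j k]
    by (simp add: choose_mult_def distrib_left distrib_right mult_closed)
qed

lemma summand_add_right:
  assumes "i \<in> I" "j \<in> I" "k \<in> I" "a \<in> carrier (B i)" "b \<in> carrier (B j)" "b' \<in> carrier (B j)"
  shows "summand i j k a (b \<oplus>\<^bsub>B j\<^esub> b') = summand i j k a b \<oplus>\<^bsub>B i\<^esub> summand i j k a b'"
proof -
  interpret unital_nonassoc_ring "B i" by (rule base_ring) fact
  show ?thesis
    using assms sigma_closed[of i j b] sigma_closed[of i j b'] alpha_closed[of i j k]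
    by (simp add: ring_hom_add[OF sigma_hom] choose_mult_def distrib_left distrib_right mult_closed)
qed

text \<open>A factor 1 makes both multiplications agree, \<open>\<sigma> i i\<close> is the
  identity, and the twist \<open>\<alpha> i i k\<close> is 1 by normalization.\<close>

lemma summand_one_left:
  assumes "i \<in> I" "k \<in> I" "b \<in> carrier (B i)"
  shows "summand i i k \<one>\<^bsub>B i\<^esub> b = b"
proof -
  interpret unital_nonassoc_ring "B i" by (rule base_ring) fact
  show ?thesis using assms
    by (simp add: alpha_normalized choose_mult_def sigma_refl unit_left unit_right)
qed

text \<open>The factor 1 again removes the flag and \<sigma>, but for general \<open>k\<close> the
  twist remains; \<open>alpha_inverse\<close> is there to undo it. The next lemma is the case
  \<open>j = k\<close>, in which the twist is 1.\<close>

lemma summand_one_right: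
  assumes "i \<in> I" "j \<in> I" "k \<in> I" "a \<in> carrier (B i)"
  shows "summand i j k a \<one>\<^bsub>B j\<^esub> = a \<otimes>\<^bsub>B i\<^esub> \<alpha> i j k"
proof -
  interpret unital_nonassoc_ring "B i" by (rule base_ring) fact
  show ?thesis using assms by (simp add: choose_mult_def sigma_one unit_left unit_right)
qed

lemma summand_one_right_normalized:
  assumes "i \<in> I" "j \<in> I" "a \<in> carrier (B i)"
  shows "summand i j j a \<one>\<^bsub>B j\<^esub> = a"
proof -
  interpret unital_nonassoc_ring "B i" by (rule base_ring) fact
  show ?thesis using assms
    by (simp add: choose_mult_def sigma_one alpha_normalized unit_left unit_right)
qed

text \<open>The defining sum runs over the support of a row of \<open>x\<close>, which varies with
  \<open>x\<close>. Any finite \<open>S\<close> outside of which one of the two factors vanishes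
  gives the same value, so that products with different left factors can be summed over a common
  set.\<close>

lemma mult_entry:
  assumes ik: "i \<in> I" "k \<in> I" and x: "x \<in> carrier M" and y: "y \<in> carrier M"
    and S: "finite S" "S \<subseteq> I"
    and null: "\<And>j. j \<in> I - S \<Longrightarrow> x (i, j) = \<zero>\<^bsub>B i\<^esub> \<or> y (j, k) = \<zero>\<^bsub>B j\<^esub>"
  shows "(x \<otimes>\<^bsub>M\<^esub> y) (i, k) = (\<Oplus>\<^bsub>B i\<^esub> j \<in> S. summand i j k (x (i, j)) (y (j, k)))"
proof -
  interpret unital_nonassoc_ring "B i" by (rule base_ring) fact
  let ?A = "{j \<in> I. x (i, j) \<noteq> \<zero>\<^bsub>B i\<^esub>}"
  let ?f = "\<lambda>j. summand i j k (x (i, j)) (y (j, k))"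
  have f: "?f j \<in> carrier (B i)" if "j \<in> I" for j
    using that ik x y by (simp add: summand_closed entry_closed)
  have "(x \<otimes>\<^bsub>M\<^esub> y) (i, k) = finsum (B i) ?f ?A"
    using ik by (simp add: skew_twisted_matrix_ring_def)
  \<comment> \<open>Neither of \<open>?A\<close> and \<open>S\<close> need contain the other, so the
    sum is first enlarged to their union and then cut down to \<open>S\<close>; the terms added and
    removed are zero.\<close>
  also have "\<dots> = finsum (B i) ?f (?A \<union> S)"
  proof (rule add.finprod_mono_neutral_cong_left)
    show "finite (?A \<union> S)" using finite_row[OF x ik(1)] S by simp
    show "?f j = \<zero>\<^bsub>B i\<^esub>" if "j \<in> ?A \<union> S - ?A" for j
    proof -
      have "j \<in> I" "x (i, j) = \<zero>\<^bsub>B i\<^esub>" using that S by auto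
      then show ?thesis using ik y by (simp add: summand_zero_left entry_closed)
    qed
  qed (use f S in auto)
  also have "\<dots> = finsum (B i) ?f S"
  proof (rule add.finprod_mono_neutral_cong_right)
    show "finite (?A \<union> S)" using finite_row[OF x ik(1)] S by simp
    show "?f j = \<zero>\<^bsub>B i\<^esub>" if "j \<in> ?A \<union> S - S" for j
    proof -
      have j: "j \<in> I" using that by auto
      from null[of j] that j have "x (i, j) = \<zero>\<^bsub>B i\<^esub> \<or> y (j, k) = \<zero>\<^bsub>B j\<^esub>" by blast
      then show ?thesis using j ik x y
        by (elim disjE) (simp_all add: summand_zero_left summand_zero_right entry_closed)
    qed
  qed (use f S in auto)
  finally show ?thesis .
qed

lemma mult_entry_single:
  assumes "i \<in> I" "j \<in> I" "k \<in> I" "x \<in> carrier M" "y \<in> carrier M"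
    and "\<And>l. l \<in> I \<Longrightarrow> l \<noteq> j \<Longrightarrow> x (i, l) = \<zero>\<^bsub>B i\<^esub> \<or> y (l, k) = \<zero>\<^bsub>B l\<^esub>"
  shows "(x \<otimes>\<^bsub>M\<^esub> y) (i, k) = summand i j k (x (i, j)) (y (j, k))"
proof -
  interpret unital_nonassoc_ring "B i" by (rule base_ring) fact
  have "summand i j k (x (i, j)) (y (j, k)) \<in> carrier (B i)"
    using assms by (simp add: summand_closed entry_closed)
  then show ?thesis
    using mult_entry[of i k x y "{j}"] assms by (simp add: finsum_insert)
qed

section \<open>The ring axioms for the matrix algebra\<close>

lemma matrix_zero_closed: "\<zero>\<^bsub>M\<^esub> \<in> carrier M"
proof (rule carrierI[where F = "{}"])
  show "\<zero>\<^bsub>M\<^esub> \<in> extensional (I \<times> I)" by (simp add: skew_twisted_matrix_ring_def)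
qed (simp_all add: zero_entry abelian_groupE(2)[OF base_abelian_group])

lemma monomial_closed:
  assumes "i \<in> I" "b \<in> carrier (B i)" shows "E b i j \<in> carrier M"
proof (rule carrierI[where F = "{(i, j)}"])
  show "E b i j \<in> extensional (I \<times> I)" by (simp add: matrix_monomial_def)
qed (use assms in \<open>auto simp: monomial_entry abelian_groupE(2)[OF base_abelian_group] split: if_splits\<close>)

lemma matrix_add_closed:
  assumes "x \<in> carrier M" "y \<in> carrier M" shows "x \<oplus>\<^bsub>M\<^esub> y \<in> carrier M"
proof (rule carrierI)
  let ?s = "\<lambda>x. {(i, j) \<in> I \<times> I. x (i, j) \<noteq> \<zero>\<^bsub>B i\<^esub>}"
  show "x \<oplus>\<^bsub>M\<^esub> y \<in> extensional (I \<times> I)" by (simp add: skew_twisted_matrix_ring_def)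
  show "finite (?s x \<union> ?s y)" using assms finite_support by blast
  fix i j assume ij: "i \<in> I" "j \<in> I"
  interpret unital_nonassoc_ring "B i" by (rule base_ring[OF ij(1)])
  show "(x \<oplus>\<^bsub>M\<^esub> y) (i, j) \<in> carrier (B i)" using ij assms by (simp add: add_entry entry_closed)
  show "(i, j) \<in> ?s x \<union> ?s y" if "(x \<oplus>\<^bsub>M\<^esub> y) (i, j) \<noteq> \<zero>\<^bsub>B i\<^esub>"
  proof (rule ccontr)
    assume "(i, j) \<notin> ?s x \<union> ?s y"
    then have "x (i, j) = \<zero>\<^bsub>B i\<^esub>" "y (i, j) = \<zero>\<^bsub>B i\<^esub>" using ij by simp_all
    then show False using that ij by (simp add: add_entry)
  qed
qed

lemma matrix_mult_closed:
  assumes x: "x \<in> carrier M" and y: "y \<in> carrier M" shows "x \<otimes>\<^bsub>M\<^esub> y \<in> carrier M"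
proof (rule carrierI)
  let ?s = "\<lambda>x. {(i, j) \<in> I \<times> I. x (i, j) \<noteq> \<zero>\<^bsub>B i\<^esub>}"
  show "x \<otimes>\<^bsub>M\<^esub> y \<in> extensional (I \<times> I)" by (simp add: skew_twisted_matrix_ring_def)
  \<comment> \<open>A non-zero entry of the product lies in a non-zero row of \<open>x\<close> and
    in a non-zero column of \<open>y\<close>.\<close>
  show "finite (fst ` ?s x \<times> snd ` ?s y)" using x y finite_support by blast
  fix i k assume ik: "i \<in> I" "k \<in> I"
  interpret unital_nonassoc_ring "B i" by (rule base_ring[OF ik(1)])
  have "(x \<otimes>\<^bsub>M\<^esub> y) (i, k) =
      (\<Oplus>\<^bsub>B i\<^esub> j \<in> {j \<in> I. x (i, j) \<noteq> \<zero>\<^bsub>B i\<^esub>}. summand i j k (x (i, j)) (y (j, k)))"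
    using ik by (simp add: skew_twisted_matrix_ring_def)
  also have "\<dots> \<in> carrier (B i)"
    by (rule finsum_closed) (use ik x y in \<open>simp add: summand_closed entry_closed\<close>)
  finally show "(x \<otimes>\<^bsub>M\<^esub> y) (i, k) \<in> carrier (B i)" .
  show "(i, k) \<in> fst ` ?s x \<times> snd ` ?s y" if nz: "(x \<otimes>\<^bsub>M\<^esub> y) (i, k) \<noteq> \<zero>\<^bsub>B i\<^esub>"
  proof -
    have "\<exists>j\<in>I. x (i, j) \<noteq> \<zero>\<^bsub>B i\<^esub> \<and> y (j, k) \<noteq> \<zero>\<^bsub>B j\<^esub>"
    proof (rule ccontr)
      assume "\<not> ?thesis"
      then have "(x \<otimes>\<^bsub>M\<^esub> y) (i, k) = \<zero>\<^bsub>B i\<^esub>"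
        \<comment> \<open>If no index \<open>j\<close> has both entries non-zero, the empty set is
          admissible as \<open>S\<close>, and the entry is an empty sum.\<close>
        by (subst mult_entry[OF ik x y, of "{}"]) auto
      with nz show False ..
    qed
    then obtain j where "(i, j) \<in> ?s x" "(j, k) \<in> ?s y" using ik by blast
    then have "i \<in> fst ` ?s x" "k \<in> snd ` ?s y" by (auto intro: rev_image_eqI)
    then show ?thesis by blast
  qed
qed

lemma matrix_abelian_group: "abelian_group M"
proof (rule abelian_groupI)
  show "\<zero>\<^bsub>M\<^esub> \<in> carrier M" by (rule matrix_zero_closed)
  fix x assume x: "x \<in> carrier M"
  show "\<zero>\<^bsub>M\<^esub> \<oplus>\<^bsub>M\<^esub> x = x"
    by (rule matrix_eqI)
      (use x abelian_groupE(5)[OF base_abelian_group] in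
        \<open>auto simp: matrix_add_closed matrix_zero_closed add_entry zero_entry entry_closed\<close>)
  define w where "w = (\<lambda>(i, j) \<in> I \<times> I. \<ominus>\<^bsub>B i\<^esub> x (i, j))"
  have w_entry: "w (i, j) = \<ominus>\<^bsub>B i\<^esub> x (i, j)" if "i \<in> I" "j \<in> I" for i j
    using that by (simp add: w_def)
  have w: "w \<in> carrier M"
  proof (rule carrierI[OF _ _ finite_support[OF x]])
    show "w \<in> extensional (I \<times> I)" by (simp add: w_def)
    fix i j assume ij: "i \<in> I" "j \<in> I"
    interpret unital_nonassoc_ring "B i" by (rule base_ring[OF ij(1)])
    show "w (i, j) \<in> carrier (B i)" using ij x by (simp add: w_entry entry_closed)
    show "(i, j) \<in> {(i, j) \<in> I \<times> I. x (i, j) \<noteq> \<zero>\<^bsub>B i\<^esub>}" if "w (i, j) \<noteq> \<zero>\<^bsub>B i\<^esub>"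
      using that ij minus_zero by (auto simp: w_entry)
  qed
  moreover have "w \<oplus>\<^bsub>M\<^esub> x = \<zero>\<^bsub>M\<^esub>"
    by (rule matrix_eqI)
      (use x w abelian_group.l_neg[OF base_abelian_group] in
        \<open>auto simp: matrix_add_closed matrix_zero_closed add_entry zero_entry entry_closed w_entry\<close>)
  ultimately show "\<exists>w\<in>carrier M. w \<oplus>\<^bsub>M\<^esub> x = \<zero>\<^bsub>M\<^esub>" by blast
next
  fix x y assume x: "x \<in> carrier M" and y: "y \<in> carrier M"
  show "x \<oplus>\<^bsub>M\<^esub> y \<in> carrier M" using x y by (rule matrix_add_closed)
  show "x \<oplus>\<^bsub>M\<^esub> y = y \<oplus>\<^bsub>M\<^esub> x"
  proof (rule matrix_eqI)
    show "(x \<oplus>\<^bsub>M\<^esub> y) (i, j) = (y \<oplus>\<^bsub>M\<^esub> x) (i, j)" if "i \<in> I" "j \<in> I" for i j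
      using that x y by (simp add: add_entry entry_closed abelian_groupE(4)[OF base_abelian_group])
  qed (use x y matrix_add_closed in simp_all)
  fix z assume z: "z \<in> carrier M"
  show "x \<oplus>\<^bsub>M\<^esub> y \<oplus>\<^bsub>M\<^esub> z = x \<oplus>\<^bsub>M\<^esub> (y \<oplus>\<^bsub>M\<^esub> z)"
  proof (rule matrix_eqI)
    show "(x \<oplus>\<^bsub>M\<^esub> y \<oplus>\<^bsub>M\<^esub> z) (i, j) = (x \<oplus>\<^bsub>M\<^esub> (y \<oplus>\<^bsub>M\<^esub> z)) (i, j)"
      if "i \<in> I" "j \<in> I" for i j
      using that x y z by (simp add: add_entry entry_closed abelian_groupE(3)[OF base_abelian_group])
  qed (use x y z matrix_add_closed in simp_all)
qed

lemma matrix_nonassoc_ring: "nonassoc_ring M"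
proof (intro nonassoc_ring.intro matrix_abelian_group nonassoc_ring_axioms.intro matrix_mult_closed)
  fix x y z assume x: "x \<in> carrier M" and y: "y \<in> carrier M" and z: "z \<in> carrier M"
  note closed = x y z matrix_add_closed matrix_mult_closed
  show "(x \<oplus>\<^bsub>M\<^esub> y) \<otimes>\<^bsub>M\<^esub> z = x \<otimes>\<^bsub>M\<^esub> z \<oplus>\<^bsub>M\<^esub> y \<otimes>\<^bsub>M\<^esub> z"
  proof (rule matrix_eqI)
    fix i k assume ik: "i \<in> I" "k \<in> I"
    interpret unital_nonassoc_ring "B i" by (rule base_ring) fact
    \<comment> \<open>One index set for all three products. The row of the sum of \<open>x\<close>
      and \<open>y\<close> may have smaller support because of cancellation, which
      \<open>mult_entry\<close> tolerates.\<close>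
    define S where "S = {j \<in> I. x (i, j) \<noteq> \<zero>\<^bsub>B i\<^esub>} \<union> {j \<in> I. y (i, j) \<noteq> \<zero>\<^bsub>B i\<^esub>}"
    have S: "finite S" "S \<subseteq> I" using finite_row x y ik by (auto simp: S_def)
    have cl: "summand i j k (u (i, j)) (z (j, k)) \<in> carrier (B i)" if "j \<in> S" "u \<in> carrier M" for j u
      using that S ik z by (simp add: subset_iff summand_closed entry_closed)
    have "((x \<oplus>\<^bsub>M\<^esub> y) \<otimes>\<^bsub>M\<^esub> z) (i, k) =
        (\<Oplus>\<^bsub>B i\<^esub> j \<in> S. summand i j k ((x \<oplus>\<^bsub>M\<^esub> y) (i, j)) (z (j, k)))"
      by (rule mult_entry) (use ik S closed in \<open>auto simp: S_def add_entry\<close>)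
    also have "\<dots> = (\<Oplus>\<^bsub>B i\<^esub> j \<in> S. summand i j k (x (i, j)) (z (j, k)) \<oplus>\<^bsub>B i\<^esub>
        summand i j k (y (i, j)) (z (j, k)))"
      by (rule finsum_cong')
        (use ik S closed cl in \<open>auto simp: subset_iff add_entry summand_add_left entry_closed\<close>)
    also have "\<dots> = (\<Oplus>\<^bsub>B i\<^esub> j \<in> S. summand i j k (x (i, j)) (z (j, k))) \<oplus>\<^bsub>B i\<^esub>
        (\<Oplus>\<^bsub>B i\<^esub> j \<in> S. summand i j k (y (i, j)) (z (j, k)))"
      by (rule finsum_addf) (use cl x y in auto)
    also have "(\<Oplus>\<^bsub>B i\<^esub> j \<in> S. summand i j k (x (i, j)) (z (j, k))) = (x \<otimes>\<^bsub>M\<^esub> z) (i, k)"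
      by (rule mult_entry[symmetric]) (use ik S closed in \<open>auto simp: S_def\<close>)
    also have "(\<Oplus>\<^bsub>B i\<^esub> j \<in> S. summand i j k (y (i, j)) (z (j, k))) = (y \<otimes>\<^bsub>M\<^esub> z) (i, k)"
      by (rule mult_entry[symmetric]) (use ik S closed in \<open>auto simp: S_def\<close>)
    finally show "((x \<oplus>\<^bsub>M\<^esub> y) \<otimes>\<^bsub>M\<^esub> z) (i, k) = (x \<otimes>\<^bsub>M\<^esub> z \<oplus>\<^bsub>M\<^esub> y \<otimes>\<^bsub>M\<^esub> z) (i, k)"
      using ik by (simp add: add_entry)
  qed (use closed in auto)
  show "z \<otimes>\<^bsub>M\<^esub> (x \<oplus>\<^bsub>M\<^esub> y) = z \<otimes>\<^bsub>M\<^esub> x \<oplus>\<^bsub>M\<^esub> z \<otimes>\<^bsub>M\<^esub> y"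
  proof (rule matrix_eqI)
    fix i k assume ik: "i \<in> I" "k \<in> I"
    interpret unital_nonassoc_ring "B i" by (rule base_ring) fact
    \<comment> \<open>The left factor is \<open>z\<close> in all three products, so the support of
      its row serves for each of them.\<close>
    define S where "S = {j \<in> I. z (i, j) \<noteq> \<zero>\<^bsub>B i\<^esub>}"
    have S: "finite S" "S \<subseteq> I" using finite_row z ik by (auto simp: S_def)
    have cl: "summand i j k (z (i, j)) (u (j, k)) \<in> carrier (B i)" if "j \<in> S" "u \<in> carrier M" for j u
      using that S ik z by (simp add: subset_iff summand_closed entry_closed)
    have entry: "(z \<otimes>\<^bsub>M\<^esub> u) (i, k) = (\<Oplus>\<^bsub>B i\<^esub> j \<in> S. summand i j k (z (i, j)) (u (j, k)))"
      if "u \<in> carrier M" for u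
      by (rule mult_entry) (use ik S closed that in \<open>auto simp: S_def\<close>)
    have "(z \<otimes>\<^bsub>M\<^esub> (x \<oplus>\<^bsub>M\<^esub> y)) (i, k) =
        (\<Oplus>\<^bsub>B i\<^esub> j \<in> S. summand i j k (z (i, j)) ((x \<oplus>\<^bsub>M\<^esub> y) (j, k)))"
      by (rule entry) (use closed in auto)
    also have "\<dots> = (\<Oplus>\<^bsub>B i\<^esub> j \<in> S. summand i j k (z (i, j)) (x (j, k)) \<oplus>\<^bsub>B i\<^esub>
        summand i j k (z (i, j)) (y (j, k)))"
      by (rule finsum_cong')
        (use ik S closed cl in \<open>auto simp: subset_iff add_entry summand_add_right entry_closed\<close>)
    also have "\<dots> = (\<Oplus>\<^bsub>B i\<^esub> j \<in> S. summand i j k (z (i, j)) (x (j, k))) \<oplus>\<^bsub>B i\<^esub>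
        (\<Oplus>\<^bsub>B i\<^esub> j \<in> S. summand i j k (z (i, j)) (y (j, k)))"
      by (rule finsum_addf) (use cl x y in auto)
    finally show "(z \<otimes>\<^bsub>M\<^esub> (x \<oplus>\<^bsub>M\<^esub> y)) (i, k) = (z \<otimes>\<^bsub>M\<^esub> x \<oplus>\<^bsub>M\<^esub> z \<otimes>\<^bsub>M\<^esub> y) (i, k)"
      using ik x y by (simp add: add_entry entry)
  qed (use closed in auto)
qed

text \<open>The negative in \<open>M\<close> is an abstract group inverse without a formula for its
  entries; uniqueness of negatives in \<open>B i\<close> determines them.\<close>

lemma uminus_entry:
  assumes "x \<in> carrier M" "i \<in> I" "j \<in> I"
  shows "(\<ominus>\<^bsub>M\<^esub> x) (i, j) = \<ominus>\<^bsub>B i\<^esub> x (i, j)"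
proof -
  interpret M: nonassoc_ring M by (rule matrix_nonassoc_ring)
  interpret unital_nonassoc_ring "B i" by (rule base_ring) fact
  have "(\<ominus>\<^bsub>M\<^esub> x) (i, j) \<oplus>\<^bsub>B i\<^esub> x (i, j) = (\<ominus>\<^bsub>M\<^esub> x \<oplus>\<^bsub>M\<^esub> x) (i, j)"
    using assms by (simp add: add_entry)
  also have "\<dots> = \<zero>\<^bsub>B i\<^esub>" using assms by (simp add: M.l_neg zero_entry)
  finally show ?thesis using assms entry_closed by (simp add: minus_equality)
qed


section \<open>Simplicity of the coefficient rings\<close>

text \<open>Since \<open>\<sigma> k i\<close> is surjective, every multiplier in \<open>B k\<close>
  is the image of one in \<open>B i\<close>, where \<open>K\<close> absorbs it.\<close>

lemma sigma_image_ideal: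
  assumes ik: "i \<in> I" "k \<in> I" and K: "two_sided_ideal K (B i)"
  shows "two_sided_ideal (\<sigma> k i ` K) (B k)"
proof -
  interpret i: unital_nonassoc_ring "B i" by (rule base_ring) fact
  interpret k: unital_nonassoc_ring "B k" by (rule base_ring) fact
  interpret K: two_sided_ideal K "B i" by fact
  note h = sigma_hom[OF ik(2,1)]
  have surj: "\<exists>x'\<in>carrier (B i). x = \<sigma> k i x'" if "x \<in> carrier (B k)" for x
    using that sigma_iso[OF ik(2,1)] by (auto simp: ring_iso_def bij_betw_def)
  show ?thesis
  proof (rule k.unital_two_sided_idealI)
    show "\<sigma> k i ` K \<subseteq> carrier (B k)" 
      using ring_hom_closed[OF h] K.a_Hcarr by (intro image_subsetI) simp
    show "\<zero>\<^bsub>B k\<^esub> \<in> \<sigma> k i ` K"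
      using imageI[OF K.zero_closed, of "\<sigma> k i"] by (simp only: sigma_zero[OF ik(2,1)])
  next
    fix a b assume "a \<in> \<sigma> k i ` K" "b \<in> \<sigma> k i ` K"
    then obtain a' b' where ab: "a = \<sigma> k i a'" "a' \<in> K" "b = \<sigma> k i b'" "b' \<in> K" by blast
    then have "a \<oplus>\<^bsub>B k\<^esub> b = \<sigma> k i (a' \<oplus>\<^bsub>B i\<^esub> b')" by (simp add: ring_hom_add[OF h] K.a_Hcarr)
    then show "a \<oplus>\<^bsub>B k\<^esub> b \<in> \<sigma> k i ` K" using ab by (simp add: K.a_closed)
  next
    fix x a assume "x \<in> carrier (B k)" "a \<in> \<sigma> k i ` K"
    then obtain x' a' where xa: "x = \<sigma> k i x'" "x' \<in> carrier (B i)" "a = \<sigma> k i a'" "a' \<in> K"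
      using surj by blast
    then have "x \<otimes>\<^bsub>B k\<^esub> a = \<sigma> k i (x' \<otimes>\<^bsub>B i\<^esub> a')" "a \<otimes>\<^bsub>B k\<^esub> x = \<sigma> k i (a' \<otimes>\<^bsub>B i\<^esub> x')"
      by (simp_all add: ring_hom_mult[OF h] K.a_Hcarr)
    then show "x \<otimes>\<^bsub>B k\<^esub> a \<in> \<sigma> k i ` K" "a \<otimes>\<^bsub>B k\<^esub> x \<in> \<sigma> k i ` K"
      using xa by (simp_all add: K.mult_left_closed K.mult_right_closed)
  qed
qed

text \<open>The rows fit together because of \<open>sigma_comp\<close>: an entry in row
  \<open>j\<close> has the form \<open>\<sigma> j i c\<close> with \<open>c\<close> in
  \<open>K\<close>, and transport by \<open>\<sigma> k j\<close> to row \<open>k\<close> turns it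
  into \<open>\<sigma> k i c\<close>, which lies in the ideal prescribed for that row.\<close>

lemma matrices_over_ideal:
  assumes i: "i \<in> I" and K: "two_sided_ideal K (B i)"
  shows "two_sided_ideal {x \<in> carrier M. \<forall>k\<in>I. \<forall>l\<in>I. x (k, l) \<in> \<sigma> k i ` K} M"
    (is "two_sided_ideal ?J M")
proof -
  interpret M: nonassoc_ring M by (rule matrix_nonassoc_ring)
  have idl: "two_sided_ideal (\<sigma> k i ` K) (B k)" if "k \<in> I" for k
    by (rule sigma_image_ideal[OF i that K])
  have sub: "additive_subgroup (\<sigma> k i ` K) (B k)" if "k \<in> I" for k
    using idl[OF that] by (simp add: two_sided_ideal_def)
  \<comment> \<open>Both absorption laws at once. In each term one factor lies in the ideal of
    \<open>B k\<close>; it absorbs the other factor under either multiplication, and then the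
    twist.\<close>
  have prod: "(x \<otimes>\<^bsub>M\<^esub> y) (k, l) \<in> \<sigma> k i ` K"
    if x: "x \<in> carrier M" and y: "y \<in> carrier M" and J: "x \<in> ?J \<or> y \<in> ?J"
      and kl: "k \<in> I" "l \<in> I" for x y k l
  proof -
    interpret k: two_sided_ideal "\<sigma> k i ` K" "B k" by (rule idl[OF kl(1)])
    have "summand k j l (x (k, j)) (y (j, l)) \<in> \<sigma> k i ` K" if j: "j \<in> I" for j
    proof -
      have "choose_mult (B k) (opp k j l) (x (k, j)) (\<sigma> k j (y (j, l))) \<in> \<sigma> k i ` K"
        using J
      proof
        assume "x \<in> ?J"
        then have "x (k, j) \<in> \<sigma> k i ` K" using j kl by blast
        then show ?thesis
          by (rule k.choose_mult_ideal_right[OF sigma_closed[OF kl(1) j entry_closed[OF y j kl(2)]]])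
      next
        assume "y \<in> ?J"
        then obtain c where c: "c \<in> K" "y (j, l) = \<sigma> j i c" using j kl by auto
        then have "\<sigma> k j (y (j, l)) = \<sigma> k i c"
          using sigma_comp[OF kl(1) j i] two_sided_ideal.axioms(1)[OF K]
          by (simp add: additive_subgroup.a_Hcarr)
        then have "\<sigma> k j (y (j, l)) \<in> \<sigma> k i ` K" using c(1) by blast
        then show ?thesis by (rule k.choose_mult_ideal_left[OF entry_closed[OF x kl(1) j]])
      qed
      then show ?thesis by (rule k.mult_right_closed[OF alpha_closed[OF kl(1) j kl(2)]])
    qed
    then show ?thesis
      using k.ideal_finsum_closed[OF abelian_group.axioms(1)[OF base_abelian_group[OF kl(1)]],
          of "{j \<in> I. x (k, j) \<noteq> \<zero>\<^bsub>B k\<^esub>}" "\<lambda>j. summand k j l (x (k, j)) (y (j, l))"] kl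
      by (simp add: skew_twisted_matrix_ring_def)
  qed
  show ?thesis
  proof (rule M.two_sided_idealI)
    show "\<zero>\<^bsub>M\<^esub> \<in> ?J"
      using additive_subgroup.zero_closed[OF sub] by (simp add: zero_entry)
    show "a \<oplus>\<^bsub>M\<^esub> b \<in> ?J" if "a \<in> ?J" "b \<in> ?J" for a b
      using that additive_subgroup.a_closed[OF sub] by (simp add: add_entry)
    show "\<ominus>\<^bsub>M\<^esub> a \<in> ?J" if "a \<in> ?J" for a
      using that additive_subgroup.a_inv_closed[OF sub] by (simp add: uminus_entry)
    show "x \<otimes>\<^bsub>M\<^esub> a \<in> ?J" "a \<otimes>\<^bsub>M\<^esub> x \<in> ?J" if "x \<in> carrier M" "a \<in> ?J" for x a
      using that prod[of x a] prod[of a x] M.mult_closed by auto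
  qed auto
qed

text \<open>As \<open>\<sigma> i i\<close> is the identity, \<open>K\<close> is recovered from the
  ideal of matrices as the set of their entries at \<open>(i, i)\<close>. Hence \<open>K\<close> is
  zero or everything as soon as the ideal of matrices is.\<close>

lemma simple_coefficients:
  assumes simple: "simple_nonassoc_ring M" and i: "i \<in> I"
  shows "simple_nonassoc_ring (B i)"
proof -
  interpret unital_nonassoc_ring "B i" by (rule base_ring) fact
  show ?thesis
  proof unfold_locales
    fix K assume K: "two_sided_ideal K (B i)"
    interpret K: two_sided_ideal K "B i" by fact
    let ?J = "{x \<in> carrier M. \<forall>k\<in>I. \<forall>l\<in>I. x (k, l) \<in> \<sigma> k i ` K}"
    have img: "\<sigma> i i ` K = K" using sigma_refl i K.a_Hcarr by (simp cong: image_cong)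
    have memJ: "E b i i \<in> ?J" if b: "b \<in> K" for b
    proof (intro CollectI conjI ballI)
      show "E b i i \<in> carrier M" by (rule monomial_closed[OF i K.a_Hcarr[OF b]])
      fix k l assume kl: "k \<in> I" "l \<in> I"
      have "\<zero>\<^bsub>B k\<^esub> \<in> \<sigma> k i ` K"
        using imageI[OF K.zero_closed, of "\<sigma> k i"] by (simp only: sigma_zero[OF kl(1) i])
      then show "E b i i (k, l) \<in> \<sigma> k i ` K" using b img by (simp add: monomial_entry[OF kl])
    qed
    from simple_nonassoc_ring.ideals_trivial[OF simple matrices_over_ideal[OF i K]]
    show "K = {\<zero>\<^bsub>B i\<^esub>} \<or> K = carrier (B i)"
    proof
      assume J: "?J = {\<zero>\<^bsub>M\<^esub>}"
      have "b = \<zero>\<^bsub>B i\<^esub>" if "b \<in> K" for b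
        using memJ[OF that] monomial_entry[OF i i, of b i i] unfolding J by (simp add: zero_entry[OF i i])
      then show ?thesis using K.zero_closed by blast
    next
      assume J: "?J = carrier M"
      have "b \<in> K" if "b \<in> carrier (B i)" for b
      proof -
        have "E b i i \<in> ?J" unfolding J by (rule monomial_closed[OF i that])
        then have "E b i i (i, i) \<in> \<sigma> i i ` K" using i by blast
        then show ?thesis using i img by (simp add: monomial_entry)
      qed
      then show ?thesis using K.a_Hcarr by blast
    qed
  qed
qed


section \<open>Simplicity of the matrix algebra\<close>

text \<open>The left factor keeps only row \<open>i\<close>, the right factor only column
  \<open>j\<close>. Neither changes the surviving coefficient, since the twists
  \<open>\<alpha> i i k\<close> and \<open>\<alpha> i j j\<close> are 1. The bracketing is part of
  the claim, as \<open>M\<close> need not be associative.\<close>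

lemma corner_entry:
  assumes ij: "i \<in> I" "j \<in> I" and x: "x \<in> carrier M"
  shows "(E \<one>\<^bsub>B i\<^esub> i i \<otimes>\<^bsub>M\<^esub> x) \<otimes>\<^bsub>M\<^esub> E \<one>\<^bsub>B j\<^esub> j j = E (x (i, j)) i j"
proof -
  interpret i: unital_nonassoc_ring "B i" by (rule base_ring) fact
  interpret j: unital_nonassoc_ring "B j" by (rule base_ring) fact
  let ?e = "E \<one>\<^bsub>B i\<^esub> i i" and ?f = "E \<one>\<^bsub>B j\<^esub> j j"
  let ?y = "?e \<otimes>\<^bsub>M\<^esub> x"
  have e: "?e \<in> carrier M" and f: "?f \<in> carrier M"
    using monomial_closed ij i.unit_closed j.unit_closed by auto
  have y: "?y \<in> carrier M" using matrix_mult_closed e x by blast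
  have y_entry: "?y (r, k) = (if r = i then x (i, k) else \<zero>\<^bsub>B r\<^esub>)" if rk: "r \<in> I" "k \<in> I" for r k
  proof -
    have "?y (r, k) = summand r i k (?e (r, i)) (x (i, k))"
      \<comment> \<open>Every column of \<open>?e\<close> except the one with index \<open>i\<close>
        is zero, so only that index contributes.\<close>
      by (rule mult_entry_single) (use rk ij e x in \<open>auto simp: monomial_entry\<close>)
    also have "\<dots> = (if r = i then x (i, k) else \<zero>\<^bsub>B r\<^esub>)"
    proof (cases "r = i")
      case True
      then show ?thesis using rk x by (simp add: monomial_entry summand_one_left entry_closed)
    next
      case False
      then show ?thesis using rk ij x
        by (simp only: monomial_entry summand_zero_left entry_closed if_False simp_thms)
    qed
    finally show ?thesis .
  qed
  show ?thesis
  proof (rule matrix_eqI)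
    fix r k assume rk: "r \<in> I" "k \<in> I"
    interpret r: unital_nonassoc_ring "B r" by (rule base_ring) fact
    have "(?y \<otimes>\<^bsub>M\<^esub> ?f) (r, k) = summand r j k (?y (r, j)) (?f (j, k))"
      by (rule mult_entry_single) (use rk ij y f in \<open>auto simp: monomial_entry\<close>)
    also have "\<dots> = E (x (i, j)) i j (r, k)"
    proof (cases "k = j")
      case True
      have "?y (r, j) \<in> carrier (B r)" by (rule entry_closed[OF y rk(1) ij(2)])
      then have "summand r j k (?y (r, j)) (?f (j, k)) = ?y (r, j)"
        using True rk ij by (simp only: monomial_entry summand_one_right_normalized simp_thms if_True)
      then show ?thesis using True rk ij by (simp add: y_entry monomial_entry)
    next
      case False
      have "?y (r, j) \<in> carrier (B r)" by (rule entry_closed[OF y rk(1) ij(2)])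
      then have "summand r j k (?y (r, j)) (?f (j, k)) = \<zero>\<^bsub>B r\<^esub>"
        using False rk ij by (simp only: monomial_entry summand_zero_right simp_thms if_False)
      then show ?thesis using False rk by (simp add: monomial_entry)
    qed
    finally show "(?y \<otimes>\<^bsub>M\<^esub> ?f) (r, k) = E (x (i, j)) i j (r, k)" .
  qed (use y f matrix_mult_closed monomial_closed[OF ij(1) entry_closed[OF x ij]] in auto)
qed

text \<open>A matrix is a finite sum of monomials; the induction splits off one position at a time
  from a finite set that contains the support.\<close>

lemma all_monomials_imp_carrier:
  assumes J: "additive_subgroup J M"
    and mono: "\<And>i j b. i \<in> I \<Longrightarrow> j \<in> I \<Longrightarrow> b \<in> carrier (B i) \<Longrightarrow> E b i j \<in> J"
  shows "J = carrier M"
proof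
  interpret J: additive_subgroup J M by fact
  show "J \<subseteq> carrier M" by (rule J.a_subset)
  have "x \<in> J" if "finite F" "x \<in> carrier M" "\<And>i j. i \<in> I \<Longrightarrow> j \<in> I \<Longrightarrow> (i, j) \<notin> F \<Longrightarrow> x (i, j) = \<zero>\<^bsub>B i\<^esub>"
    for F x using that
  proof (induction F arbitrary: x rule: finite_induct)
    case empty
    then have "x = \<zero>\<^bsub>M\<^esub>"
      by (intro matrix_eqI) (auto simp: matrix_zero_closed zero_entry)
    then show ?case by (simp add: J.zero_closed)
  next
    case (insert p F)
    note x = insert.prems(1)
    obtain i j where p: "p = (i, j)" by (cases p)
    show ?case
    proof (cases "i \<in> I \<and> j \<in> I")
      \<comment> \<open>A position outside \<open>I \<times> I\<close> imposes no condition on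
        entries, so \<open>x\<close> already satisfies the hypothesis for \<open>F\<close>.\<close>
      case False
      then show ?thesis using insert p by auto
    next
      case True
      then have ij: "i \<in> I" "j \<in> I" by auto
      interpret i: unital_nonassoc_ring "B i" by (rule base_ring) fact
      \<comment> \<open>Clearing the entry at \<open>p\<close> leaves a matrix supported in
        \<open>F\<close>, and the difference from \<open>x\<close> is a single monomial.\<close>
      define y where "y = x((i, j) := \<zero>\<^bsub>B i\<^esub>)"
      have y: "y \<in> carrier M"
      proof (rule carrierI[OF _ _ finite_support[OF x]])
        show "y \<in> extensional (I \<times> I)"
          using x ij unfolding carrier_iff by (auto simp: y_def extensional_def)
      qed (use x in \<open>auto simp: y_def entry_closed split: if_splits\<close>)
      have E: "E (x (i, j)) i j \<in> J" using mono ij entry_closed[OF x] by blast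
      have "y \<in> J"
      proof (rule insert.IH[OF y])
        fix k l assume "k \<in> I" "l \<in> I" "(k, l) \<notin> F"
        then show "y (k, l) = \<zero>\<^bsub>B k\<^esub>" using insert.prems(2)[of k l] p by (auto simp: y_def)
      qed
      moreover have "x = E (x (i, j)) i j \<oplus>\<^bsub>M\<^esub> y"
      proof (rule matrix_eqI[OF x])
        show "E (x (i, j)) i j \<oplus>\<^bsub>M\<^esub> y \<in> carrier M" using E y J.a_Hcarr matrix_add_closed by blast
        fix k l assume kl: "k \<in> I" "l \<in> I"
        interpret k: unital_nonassoc_ring "B k" by (rule base_ring) fact
        show "x (k, l) = (E (x (i, j)) i j \<oplus>\<^bsub>M\<^esub> y) (k, l)"
          using kl entry_closed[OF x kl] by (auto simp: add_entry monomial_entry y_def)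
      qed
      ultimately show ?thesis using E J.a_closed by metis
    qed
  qed
  then show "carrier M \<subseteq> J" by (force simp: carrier_iff)
qed

text \<open>At the position \<open>(i, i)\<close> both \<sigma> and the twist are trivial, so
  monomials multiply there as their coefficients do under the chosen multiplication of
  \<open>B i\<close>.\<close>

lemma diagonal_ideal:
  assumes J: "two_sided_ideal J M" and i: "i \<in> I"
  shows "two_sided_ideal {b \<in> carrier (B i). E b i i \<in> J} (B i)" (is "two_sided_ideal ?K _")
proof -
  interpret J: two_sided_ideal J M by fact
  interpret i: unital_nonassoc_ring "B i" by (rule base_ring) fact
  have prod: "E (choose_mult (B i) (opp i i i) a b) i i \<in> J"
    if ab: "a \<in> carrier (B i)" "b \<in> carrier (B i)" "E a i i \<in> J \<or> E b i i \<in> J" for a b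
  proof -
    have "E a i i \<otimes>\<^bsub>M\<^esub> E b i i = E (summand i i i a b) i i"
      using matrix_monomial_mult i ab by simp
    also have "summand i i i a b = choose_mult (B i) (opp i i i) a b"
      using i ab by (simp add: sigma_refl alpha_normalized choose_mult_def i.unit_right i.mult_closed)
    finally show ?thesis
      using ab i monomial_closed J.mult_left_closed J.mult_right_closed by metis
  qed
  \<comment> \<open>If the chosen multiplication is the opposite one, the ordinary product of
    \<open>a\<close> and \<open>b\<close> is the chosen product of \<open>b\<close> and
    \<open>a\<close>. The disjunctive hypothesis is symmetric, so \<open>prod\<close> applies in
    either order.\<close>
  have prod': "E (a \<otimes>\<^bsub>B i\<^esub> b) i i \<in> J"
    if "a \<in> carrier (B i)" "b \<in> carrier (B i)" "E a i i \<in> J \<or> E b i i \<in> J" for a b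
    using that prod[of a b] prod[of b a] by (cases "opp i i i") (auto simp: choose_mult_def)
  show ?thesis
  proof (rule i.unital_two_sided_idealI)
    have "E \<zero>\<^bsub>B i\<^esub> i i = \<zero>\<^bsub>M\<^esub>"
      by (rule matrix_eqI)
        (use i in \<open>auto simp: monomial_closed matrix_zero_closed monomial_entry zero_entry\<close>)
    then show "\<zero>\<^bsub>B i\<^esub> \<in> ?K" by (simp add: J.zero_closed)
  next
    fix a b assume ab: "a \<in> ?K" "b \<in> ?K"
    have "E (a \<oplus>\<^bsub>B i\<^esub> b) i i = E a i i \<oplus>\<^bsub>M\<^esub> E b i i"
    proof (rule matrix_eqI)
      fix k l assume kl: "k \<in> I" "l \<in> I"
      interpret k: unital_nonassoc_ring "B k" by (rule base_ring) fact
      show "E (a \<oplus>\<^bsub>B i\<^esub> b) i i (k, l) = (E a i i \<oplus>\<^bsub>M\<^esub> E b i i) (k, l)"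
        using kl by (simp add: monomial_entry add_entry)
    qed (use ab i in \<open>auto simp: monomial_closed matrix_add_closed\<close>)
    then show "a \<oplus>\<^bsub>B i\<^esub> b \<in> ?K" using ab by (simp add: J.a_closed)
  qed (auto simp: prod' i.mult_closed)
qed

lemma simple_matrix_ring:
  assumes simple: "\<And>i. i \<in> I \<Longrightarrow> simple_nonassoc_ring (B i)"
  shows "simple_nonassoc_ring M"
proof -
  interpret M: nonassoc_ring M by (rule matrix_nonassoc_ring)
  show ?thesis
  proof unfold_locales
    fix J assume J: "two_sided_ideal J M"
    interpret J: two_sided_ideal J M by fact
    show "J = {\<zero>\<^bsub>M\<^esub>} \<or> J = carrier M"
    proof (cases "J = {\<zero>\<^bsub>M\<^esub>}")
      case False
      then obtain x where xJ: "x \<in> J" and "x \<noteq> \<zero>\<^bsub>M\<^esub>" using J.zero_closed by auto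
      moreover from xJ have x: "x \<in> carrier M" by (rule J.a_Hcarr)
      ultimately obtain i j where ij: "i \<in> I" "j \<in> I" and nz: "x (i, j) \<noteq> \<zero>\<^bsub>B i\<^esub>"
        using matrix_eqI[OF x matrix_zero_closed] by (metis zero_entry)
      interpret i: unital_nonassoc_ring "B i" by (rule base_ring) fact
      interpret j: unital_nonassoc_ring "B j" by (rule base_ring) fact
      let ?b = "x (i, j)"
      have b: "?b \<in> carrier (B i)" by (rule entry_closed[OF x ij])
      have bJ: "E ?b i j \<in> J"
        using corner_entry[OF ij x] xJ ij i.unit_closed j.unit_closed
        by (metis J.mult_left_closed J.mult_right_closed monomial_closed)
      \<comment> \<open>Because one coefficient is 1, moving to the diagonal costs only the twist
        \<open>\<alpha> i j i\<close>.\<close>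
      have "E ?b i j \<otimes>\<^bsub>M\<^esub> E \<one>\<^bsub>B j\<^esub> j i = E (summand i j i ?b \<one>\<^bsub>B j\<^esub>) i i"
        using matrix_monomial_mult ij b j.unit_closed by simp
      also have "summand i j i ?b \<one>\<^bsub>B j\<^esub> = ?b \<otimes>\<^bsub>B i\<^esub> \<alpha> i j i"
        by (rule summand_one_right[OF ij ij(1) b])
      finally have bJ': "E (?b \<otimes>\<^bsub>B i\<^esub> \<alpha> i j i) i i \<in> J"
        using bJ ij j.unit_closed by (metis J.mult_right_closed monomial_closed)
      \<comment> \<open>Cancelling the twist gives back \<open>?b\<close>, so the coefficient on the
        diagonal is still non-zero.\<close>
      obtain \<beta> where \<beta>: "\<beta> \<in> carrier (B i)" "(?b \<otimes>\<^bsub>B i\<^esub> \<alpha> i j i) \<otimes>\<^bsub>B i\<^esub> \<beta> = ?b"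
        using alpha_inverse[OF ij(1) ij(2) ij(1)] b by metis
      then have nz': "?b \<otimes>\<^bsub>B i\<^esub> \<alpha> i j i \<noteq> \<zero>\<^bsub>B i\<^esub>" using nz i.mult_zero_left by auto
      let ?K = "{b \<in> carrier (B i). E b i i \<in> J}"
      have "?b \<otimes>\<^bsub>B i\<^esub> \<alpha> i j i \<in> ?K" using bJ' b alpha_closed ij i.mult_closed by blast
      then have "?K = carrier (B i)"
        using nz' simple_nonassoc_ring.ideals_trivial[OF simple[OF ij(1)] diagonal_ideal[OF J ij(1)]]
        by blast
      then have diag: "E b i i \<in> J" if "b \<in> carrier (B i)" for b using that by blast
      \<comment> \<open>The monomial is built from the one with coefficient 1 at
        \<open>(i, i)\<close>: a left multiplication moves it to row \<open>k\<close>, a right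
        multiplication then moves it to column \<open>l\<close>.\<close>
      have "E d k l \<in> J" if kl: "k \<in> I" "l \<in> I" and d: "d \<in> carrier (B k)" for d k l
      proof -
        interpret k: unital_nonassoc_ring "B k" by (rule base_ring) fact
        \<comment> \<open>The first move brings the trivial twist \<open>\<alpha> k i i\<close>, the
          second brings \<open>\<alpha> k i l\<close>. Dividing \<open>d\<close> by the latter in
          advance makes the final coefficient exactly \<open>d\<close>.\<close>
        obtain \<beta> where \<beta>: "\<beta> \<in> carrier (B k)" "(d \<otimes>\<^bsub>B k\<^esub> \<beta>) \<otimes>\<^bsub>B k\<^esub> \<alpha> k i l = d"
          using alpha_inverse[OF kl(1) ij(1) kl(2)] d by metis
        let ?d = "d \<otimes>\<^bsub>B k\<^esub> \<beta>"
        have d': "?d \<in> carrier (B k)" using d \<beta>(1) by (rule k.mult_closed)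
        have "E ?d k i \<otimes>\<^bsub>M\<^esub> E \<one>\<^bsub>B i\<^esub> i i = E (summand k i i ?d \<one>\<^bsub>B i\<^esub>) k i"
          using matrix_monomial_mult ij kl d' i.unit_closed by simp
        also have "summand k i i ?d \<one>\<^bsub>B i\<^esub> = ?d"
          by (rule summand_one_right_normalized[OF kl(1) ij(1) d'])
        finally have dJ: "E ?d k i \<in> J"
          using diag[OF i.unit_closed] kl d' by (metis J.mult_left_closed monomial_closed)
        have "E ?d k i \<otimes>\<^bsub>M\<^esub> E \<one>\<^bsub>B i\<^esub> i l = E (summand k i l ?d \<one>\<^bsub>B i\<^esub>) k l"
          using matrix_monomial_mult ij kl d' i.unit_closed by simp
        also have "summand k i l ?d \<one>\<^bsub>B i\<^esub> = d"
          using ij kl d' \<beta>(2) by (simp only: summand_one_right)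
        finally show ?thesis
          using dJ ij i.unit_closed by (metis J.mult_right_closed monomial_closed)
      qed
      then show ?thesis using all_monomials_imp_carrier[OF J.additive_subgroup_axioms] by blast
    qed simp
  qed
qed

end

end


section \<open>Cayley-Dickson algebras\<close>

text \<open>The copy of the real numbers inside \<open>C_n\<close>. The level is an argument because
  elements of different \<open>C_n\<close> are trees of different heights.\<close>

primrec cd_scalar :: "nat \<Rightarrow> real \<Rightarrow> cd_tree" where
  "cd_scalar 0 r = Scalar r"
| "cd_scalar (Suc n) r = Double (cd_scalar n r) (cd_scalar n 0)"

text \<open>The squared Euclidean norm, with \<open>C_n\<close> regarded as real space of dimension
  \<open>2^n\<close>.\<close>

primrec cd_norm2 :: "cd_tree \<Rightarrow> real" where
  "cd_norm2 (Scalar r) = r\<^sup>2"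
| "cd_norm2 (Double a b) = cd_norm2 a + cd_norm2 b"

lemma cd_norm2_nonneg: "0 \<le> cd_norm2 x"
  by (induction x) auto

lemma cd_unital: "unital_nonassoc_ring (cayley_dickson n)"
  using nonzero_star_ring_cayley_dickson by (simp add: nonzero_star_ring_def)

lemma cd_involution_closed:
  "x \<in> carrier (cayley_dickson n) \<Longrightarrow> involution (cayley_dickson n) x \<in> carrier (cayley_dickson n)"
  using nonzero_star_ring_cayley_dickson by (auto simp: nonzero_star_ring_def)

lemma cd_scalar_closed: "cd_scalar n r \<in> carrier (cayley_dickson n)"
  by (induction n arbitrary: r) (auto simp: real_star_ring_def cd_double_def)

lemma cd_scalar_zero: "cd_scalar n 0 = \<zero>\<^bsub>cayley_dickson n\<^esub>"
  by (induction n) (auto simp: real_star_ring_def cd_double_def)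

lemma cd_scalar_one: "cd_scalar n 1 = \<one>\<^bsub>cayley_dickson n\<^esub>"
  by (induction n) (auto simp: real_star_ring_def cd_double_def cd_scalar_zero)

lemma cd_scalar_add:
  "cd_scalar n (r + s) = cd_scalar n r \<oplus>\<^bsub>cayley_dickson n\<^esub> cd_scalar n s"
proof (induction n arbitrary: r s)
  case (Suc n)
  \<comment> \<open>The right half of every embedded real is the embedded 0, so its additivity
    amounts to this instance.\<close>
  have "cd_scalar n 0 = cd_scalar n 0 \<oplus>\<^bsub>cayley_dickson n\<^esub> cd_scalar n 0"
    using Suc[of 0 0] by simp
  then show ?case using Suc[of r s] by (simp add: cd_double_def)
qed (simp add: real_star_ring_def)

lemma cd_involution_zero:
  "involution (cayley_dickson n) \<zero>\<^bsub>cayley_dickson n\<^esub> = \<zero>\<^bsub>cayley_dickson n\<^esub>"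
proof (induction n)
  case (Suc n)
  interpret unital_nonassoc_ring "cayley_dickson n" by (rule cd_unital)
  show ?case using Suc by (simp add: cd_double_def)
qed (simp add: real_star_ring_def)

lemma cd_scalar_mult:
  "cd_scalar n (r * s) = cd_scalar n r \<otimes>\<^bsub>cayley_dickson n\<^esub> cd_scalar n s"
proof (induction n arbitrary: r s)
  case (Suc n)
  interpret unital_nonassoc_ring "cayley_dickson n" by (rule cd_unital)
  show ?case using Suc[of r s] cd_scalar_closed[of n]
    by (simp add: cd_double_def cd_scalar_zero cd_involution_zero cd_involution_closed
        mult_zero_left mult_zero_right mult_closed a_minus_def Let_def)
qed (simp add: real_star_ring_def)

text \<open>Write \<open>x'\<close> for the conjugate. For \<open>x = a + b u\<close> the doubling
  formula gives \<open>x x' = (a a' + b' b) + (- b a + b a'') u\<close>. This uses the second and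
  third claims at the level below, so all three are proved together.\<close>

lemma cd_mult_involution:
  assumes "x \<in> carrier (cayley_dickson n)"
  shows "x \<otimes>\<^bsub>cayley_dickson n\<^esub> involution (cayley_dickson n) x = cd_scalar n (cd_norm2 x) \<and>
    involution (cayley_dickson n) x \<otimes>\<^bsub>cayley_dickson n\<^esub> x = cd_scalar n (cd_norm2 x) \<and>
    involution (cayley_dickson n) (involution (cayley_dickson n) x) = x"
  using assms
proof (induction n arbitrary: x)
  case 0
  then show ?case by (auto simp: real_star_ring_def power2_eq_square)
next
  case (Suc n)
  interpret unital_nonassoc_ring "cayley_dickson n" by (rule cd_unital)
  obtain a b where x: "x = Double a b" and
    ab: "a \<in> carrier (cayley_dickson n)" "b \<in> carrier (cayley_dickson n)"
    using Suc.prems by (auto simp: cd_double_def)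
  note inv = cd_involution_closed[OF ab(1)] cd_involution_closed[OF ab(2)]
  have ad: "involution (cayley_dickson n) (u \<oplus>\<^bsub>cayley_dickson n\<^esub> v) =
    involution (cayley_dickson n) u \<oplus>\<^bsub>cayley_dickson n\<^esub> involution (cayley_dickson n) v"
    if "u \<in> carrier (cayley_dickson n)" "v \<in> carrier (cayley_dickson n)" for u v
    using that nonzero_star_ring_cayley_dickson by (simp add: nonzero_star_ring_def)
  let ?m = "\<lambda>u. \<ominus>\<^bsub>cayley_dickson n\<^esub> u"
  \<comment> \<open>The involution is known only to be additive; that it respects negatives follows
    from their uniqueness. The same argument gives the sign rules for products.\<close>
  have neg_inv: "involution (cayley_dickson n) (?m b) = ?m (involution (cayley_dickson n) b)"
    using ad[of "?m b" b] ab inv cd_involution_closed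
    by (metis a_inv_closed cd_involution_zero l_neg minus_equality)
  have neg_left: "?m u \<otimes>\<^bsub>cayley_dickson n\<^esub> v = ?m (u \<otimes>\<^bsub>cayley_dickson n\<^esub> v)"
    if "u \<in> carrier (cayley_dickson n)" "v \<in> carrier (cayley_dickson n)" for u v
    using that distrib_right[of "?m u" u v]
    by (metis a_inv_closed l_neg minus_equality mult_closed mult_zero_left)
  have neg_right: "v \<otimes>\<^bsub>cayley_dickson n\<^esub> ?m u = ?m (v \<otimes>\<^bsub>cayley_dickson n\<^esub> u)"
    if "u \<in> carrier (cayley_dickson n)" "v \<in> carrier (cayley_dickson n)" for u v
    using that distrib_left[of "?m u" u v]
    by (metis a_inv_closed l_neg minus_equality mult_closed mult_zero_right)
  show ?case
    using Suc.IH[OF ab(1)] Suc.IH[OF ab(2)] ab inv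
    by (simp add: x cd_double_def neg_inv neg_left neg_right a_minus_def mult_closed
        cd_scalar_add cd_scalar_closed cd_scalar_zero l_neg r_neg)
qed

lemma cd_norm2_eq_zero:
  assumes "x \<in> carrier (cayley_dickson n)" "cd_norm2 x = 0"
  shows "x = \<zero>\<^bsub>cayley_dickson n\<^esub>"
  using assms
proof (induction n arbitrary: x)
  case 0
  then show ?case by (auto simp: real_star_ring_def)
next
  case (Suc n)
  then obtain a b where x: "x = Double a b"
    and ab: "a \<in> carrier (cayley_dickson n)" "b \<in> carrier (cayley_dickson n)"
    by (auto simp: cd_double_def)
  have "cd_norm2 a = 0" "cd_norm2 b = 0"
    using Suc.prems(2) cd_norm2_nonneg[of a] cd_norm2_nonneg[of b] by (simp_all add: x)
  then have "a = \<zero>\<^bsub>cayley_dickson n\<^esub>" "b = \<zero>\<^bsub>cayley_dickson n\<^esub>"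
    using Suc.IH ab by blast+
  then show ?case by (simp only: x) (simp add: cd_double_def)
qed

text \<open>The zero divisors that occur from the sedenions on do no harm: an ideal that contains
  \<open>x\<close> contains the real number \<open>x\<close> times its conjugate, and multiplication
  by the real reciprocal of that number yields 1.\<close>

lemma cd_simple: "simple_nonassoc_ring (cayley_dickson n)"
proof -
  interpret unital_nonassoc_ring "cayley_dickson n" by (rule cd_unital)
  show ?thesis
  proof unfold_locales
    fix J assume J: "two_sided_ideal J (cayley_dickson n)"
    interpret J: two_sided_ideal J "cayley_dickson n" by fact
    show "J = {\<zero>\<^bsub>cayley_dickson n\<^esub>} \<or> J = carrier (cayley_dickson n)"
    proof (cases "J = {\<zero>\<^bsub>cayley_dickson n\<^esub>}")
      case False
      then obtain x where x: "x \<in> J" "x \<noteq> \<zero>\<^bsub>cayley_dickson n\<^esub>" using J.zero_closed by auto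
      then have nz: "cd_norm2 x \<noteq> 0" using cd_norm2_eq_zero J.a_Hcarr by blast
      have "cd_scalar n (cd_norm2 x) \<in> J"
        using x cd_mult_involution[of x n] cd_involution_closed J.a_Hcarr J.mult_right_closed by metis
      then have "cd_scalar n (1 / cd_norm2 x * cd_norm2 x) \<in> J"
        unfolding cd_scalar_mult using cd_scalar_closed J.mult_left_closed by blast
      then have "\<one>\<^bsub>cayley_dickson n\<^esub> \<in> J" using nz by (simp add: cd_scalar_one)
      then show ?thesis using ideal_eq_carrierI[OF J] by blast
    qed simp
  qed
qed


text \<open>The first half concerns coefficients of an arbitrary fixed type, the second coefficients
  in \<open>cd_tree\<close>; both use \<open>simple_matrix_ring\<close>, the second with
  \<open>cd_simple\<close> as its input.\<close>

theorem proposition3p25: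
  fixes I :: "'i set"
  shows "(\<forall>(B :: 'i \<Rightarrow> ('b, 'm) ring_scheme) \<sigma> \<alpha> opp.
            skew_twisted_data I B \<sigma> \<alpha> \<longrightarrow>
              (simple_nonassoc_ring (skew_twisted_matrix_ring I B \<sigma> \<alpha> opp) \<longleftrightarrow>
                (\<forall>i\<in>I. simple_nonassoc_ring (B i)))) \<and>
         (\<forall>n \<sigma> \<alpha> opp.
            skew_twisted_data I (\<lambda>i. cayley_dickson n) \<sigma> \<alpha> \<longrightarrow>
              simple_nonassoc_ring (skew_twisted_matrix_ring I (\<lambda>i. cayley_dickson n) \<sigma> \<alpha> opp))"
proof (intro conjI allI impI iffI ballI)
  fix B :: "'i \<Rightarrow> ('b, 'm) ring_scheme" and \<sigma> \<alpha> opp i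
  assume data: "skew_twisted_data I B \<sigma> \<alpha>"
  show "simple_nonassoc_ring (B i)"
    if "simple_nonassoc_ring (skew_twisted_matrix_ring I B \<sigma> \<alpha> opp)" "i \<in> I"
    using data that by (rule skew_twisted_data.simple_coefficients)
  show "simple_nonassoc_ring (skew_twisted_matrix_ring I B \<sigma> \<alpha> opp)"
    if "\<forall>i\<in>I. simple_nonassoc_ring (B i)"
    by (rule skew_twisted_data.simple_matrix_ring[OF data]) (use that in blast)
next
  fix n \<sigma> \<alpha> opp
  assume "skew_twisted_data I (\<lambda>i. cayley_dickson n) \<sigma> \<alpha>"
  then show "simple_nonassoc_ring (skew_twisted_matrix_ring I (\<lambda>i. cayley_dickson n) \<sigma> \<alpha> opp)"
    by (rule skew_twisted_data.simple_matrix_ring) (rule cd_simple)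
qed

end
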